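(* Let $A$ be a complex $n\times n$ matrix with minimal polynomial $m$ of degree $|m|$, and let $\|\cdot\|$ be an arbitrary matrix norm (any norm on the space of complex $n\times n$ matrices) with $\sup_{k\geq0}\|A^k\|=C<\infty$. For any $\zeta\in\overline{\mathbb{D}}\setminus\sigma(A)$ it holds that $$\|(\zeta-A)^{-1}\|\leq\frac{2|m|\,C}{\min_{\lambda_i\in\sigma(A)}|1-\bar{\zeta}\lambda_i|^{1/2}\,\Big(2|m|-2|m||\zeta|^2+|\zeta|^2\min_{\lambda_i\in\sigma(A)}|1-\bar{\zeta}\lambda_i|\Big)^{1/2}}\left(\frac{4e}{|B(\zeta)|^2}-1\right)^{1/2},$$ where $B(\zeta)=\prod_{i=1}^{|m|}\frac{\zeta-\lambda_i}{1-\bar{\lambda}_i\zeta}$ is the Blaschke product associated with $m$. For $|\zeta|>1$, one has $\|(\zeta-A)^{-1}\|\leq\frac{C}{|\zeta|-1}$.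
   Context: $\mathbb{D}$ is the open unit disk, $\overline{\mathbb{D}}$ its closure, $\sigma(A)$ the spectrum of $A$, and $e$ is Euler's number. The zeros $\lambda_1,\dots,\lambda_{|m|}$ of $m$ are listed with their multiplicity in the minimal polynomial $m$. *)

theory Defs
  imports
    "HOL-Analysis.Analysis"
    "Jordan_Normal_Form.Spectral_Radius"
begin

(* Submultiplicativity is deliberately not required. *)
definition is_matrix_norm :: "nat \<Rightarrow> (complex mat \<Rightarrow> real) \<Rightarrow> bool" where
  "is_matrix_norm n N \<longleftrightarrow>
     (\<forall>A \<in> carrier_mat n n. 0 \<le> N A) \<and>
     (\<forall>A \<in> carrier_mat n n. N A = 0 \<longleftrightarrow> A = 0\<^sub>m n n) \<and>
     (\<forall>A \<in> carrier_mat n n. \<forall>c. N (c \<cdot>\<^sub>m A) = cmod c * N A) \<and>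
     (\<forall>A \<in> carrier_mat n n. \<forall>B \<in> carrier_mat n n. N (A + B) \<le> N A + N B)"

definition poly_at_mat :: "'a :: comm_ring_1 poly \<Rightarrow> 'a mat \<Rightarrow> 'a mat" where
  "poly_at_mat p A =
     mat (dim_row A) (dim_row A) (\<lambda>(i, j). \<Sum>k\<le>degree p. coeff p k * (A ^\<^sub>m k) $$ (i, j))"

definition is_minimal_polynomial :: "'a :: field mat \<Rightarrow> 'a poly \<Rightarrow> bool" where
  "is_minimal_polynomial A m \<longleftrightarrow>
     lead_coeff m = 1 \<and>
     poly_at_mat m A = 0\<^sub>m (dim_row A) (dim_row A) \<and>
     (\<forall>p. p \<noteq> 0 \<longrightarrow> poly_at_mat p A = 0\<^sub>m (dim_row A) (dim_row A) \<longrightarrow> degree m \<le> degree p)"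

definition blaschke_product :: "complex poly \<Rightarrow> complex \<Rightarrow> complex" where
  "blaschke_product m \<zeta> = (\<Prod>l\<in>#proots m. (\<zeta> - l) / (1 - cnj l * \<zeta>))"

(* Meaningful only if the matrix \<zeta> - A is invertible; otherwise the value is unspecified. *)
definition resolvent_mat :: "'a :: field mat \<Rightarrow> 'a \<Rightarrow> 'a mat" where
  "resolvent_mat A \<zeta> = the (mat_inverse (\<zeta> \<cdot>\<^sub>m 1\<^sub>m (dim_row A) - A))"

end

theory Submission
  imports
    Defs
    "HOL-Computational_Algebra.Polynomial_FPS"
    "HOL-Computational_Algebra.Fundamental_Theorem_Algebra"
    "HOL-Computational_Algebra.Field_as_Ring"
begin

text \<open>
  Write \<open>d\<close> for the degree of \<open>m\<close>. The map \<open>p \<mapsto> N (p(A))\<close> is a norm on the quotient ring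
  \<open>\<complex>[X]/(m)\<close>, and power-boundedness says that all powers of \<open>X\<close> have norm at most \<open>C\<close>. Hence
  \<open>N (f(A)) \<le> C * \<Sum>|f\<^sub>k|\<close> for every power series \<open>f = \<Sum> f\<^sub>k X^k\<close> with absolutely summable
  coefficients, and \<open>f(A)\<close> depends only on \<open>f\<close> modulo \<open>m\<close>. To bound the resolvent it suffices to
  choose, among the functions that agree with \<open>1/(\<zeta> - X)\<close> modulo \<open>m\<close>, one whose coefficients have
  small absolute sum. For \<open>|\<zeta>| > 1\<close> the geometric series itself is good enough.

  For \<open>|\<zeta>| \<le> 1\<close> fix \<open>0 < r < 1\<close> and let
  \<open>\<beta>(z) = \<Prod> r(z - \<lambda>\<^sub>i)/(1 - r\<^sup>2 \<lambda>\<^sub>i\<^sup>* z)\<close>, the Blaschke product with zeros \<open>r\<lambda>\<^sub>i\<close> evaluated at \<open>rz\<close>.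
  As \<open>\<beta>\<close> is divisible by \<open>m\<close>, the function \<open>f = F/\<beta>(\<zeta>)\<close> with \<open>F = (\<beta>(z) - \<beta>(\<zeta>))/(z - \<zeta>)\<close> is
  admissible. In the scaled variable, \<open>F\<close> is a difference quotient of an inner function, whose Hardy
  norm is known, so that
  \<open>\<Sum>|F\<^sub>k|\<^sup>2/r^(2k) \<le> r\<^sup>2 (1 - |\<beta>(\<zeta>)|\<^sup>2)/(1 - r\<^sup>2|\<zeta>|\<^sup>2)\<close>; this is \<open>blaschke_difference_quotient\<close>, proved
  by induction on the number of zeros from the energy balance of a first-order all-pass filter
  (\<open>allpass_section\<close>). Cauchy-Schwarz with \<open>\<Sum>r^(2k) = 1/(1 - r\<^sup>2)\<close> then bounds the resolvent
  (\<open>resolvent_le_blaschke\<close>).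

  With \<open>\<mu> = min |1 - \<zeta>\<^sup>*\<lambda>\<^sub>i|\<close>, the choice \<open>r\<^sup>2 = 1 - \<mu>/(2d)\<close> turns \<open>1 - r\<^sup>2\<close> and \<open>1 - r\<^sup>2|\<zeta>|\<^sup>2\<close> into the
  two factors of the denominator, and it costs only a constant to replace \<open>\<beta>(\<zeta>)\<close> by \<open>B(\<zeta>)\<close>:
  \<open>|B(\<zeta>)|\<^sup>2 \<le> (1 + 1/(2d))^(2d) (1 - \<mu>/(2d))^(-d) |\<beta>(\<zeta>)|\<^sup>2\<close>, where the first factor is at most \<open>e\<close> and
  the second at most \<open>4\<close> when \<open>d \<ge> 2\<close> (\<open>blaschke_dilation_le\<close>). For \<open>d = 1\<close> this \<open>r\<close> may be \<open>0\<close>,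
  but then the resolvent is a constant modulo \<open>m\<close> and can be estimated directly.
\<close>

section \<open>The absolute coefficient sum of a polynomial\<close>

text \<open>The norm of the Wiener algebra, restricted to polynomials.\<close>
definition l1_norm :: "complex poly \<Rightarrow> real" where
  "l1_norm p = (\<Sum>k\<le>degree p. cmod (coeff p k))"

lemma l1_norm_altdef: "degree p \<le> L \<Longrightarrow> l1_norm p = (\<Sum>k\<le>L. cmod (coeff p k))"
  unfolding l1_norm_def by (intro sum.mono_neutral_left) (auto simp: coeff_eq_0)

lemma l1_norm_nonneg: "0 \<le> l1_norm p"
  unfolding l1_norm_def by (intro sum_nonneg) auto

lemma l1_norm_0 [simp]: "l1_norm 0 = 0"
  by (simp add: l1_norm_def)

lemma l1_norm_add_le: "l1_norm (p + q) \<le> l1_norm p + l1_norm q"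
proof -
  let ?L = "max (degree p) (degree q)"
  have "l1_norm (p + q) = (\<Sum>k\<le>?L. cmod (coeff p k + coeff q k))"
    by (subst l1_norm_altdef[of _ ?L]) (auto intro: degree_add_le)
  also have "\<dots> \<le> (\<Sum>k\<le>?L. cmod (coeff p k) + cmod (coeff q k))"
    by (intro sum_mono norm_triangle_ineq)
  also have "\<dots> = l1_norm p + l1_norm q"
    by (simp add: sum.distrib l1_norm_altdef[of p ?L] l1_norm_altdef[of q ?L])
  finally show ?thesis .
qed

lemma l1_norm_pCons [simp]: "l1_norm (pCons a p) = cmod a + l1_norm p"
  by (simp add: l1_norm_altdef[of "pCons a p" "Suc (degree p)"] l1_norm_def sum.atMost_Suc_shift
        degree_pCons_le del: sum.atMost_Suc)

lemma l1_norm_smult [simp]: "l1_norm (Polynomial.smult c p) = cmod c * l1_norm p"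
  by (induction p) (auto simp: norm_mult algebra_simps)

lemma l1_norm_mult_le: "l1_norm (p * q) \<le> l1_norm p * l1_norm q"
proof (induction p)
  case (pCons a p)
  have "l1_norm (pCons a p * q) \<le> l1_norm (Polynomial.smult a q) + l1_norm (pCons 0 (p * q))"
    unfolding mult_pCons_left by (rule l1_norm_add_le)
  also have "\<dots> \<le> l1_norm (pCons a p) * l1_norm q"
    using pCons by (simp add: algebra_simps)
  finally show ?case .
qed simp

lemma l1_norm_monom_mult [simp]: "l1_norm (monom c k * p) = cmod c * l1_norm p"
  by (induction k) (simp_all add: monom_0 monom_Suc)

lemma l1_norm_monom [simp]: "l1_norm (monom c k) = cmod c"
  by (induction k) (simp_all add: monom_0 monom_Suc)

lemma l1_norm_truncate_fps: "l1_norm (truncate_fps K F) = (\<Sum>k<K. cmod (fps_nth F k))"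
proof (cases K)
  case (Suc K')
  then have "degree (truncate_fps K F) \<le> K'"
    using degree_truncate_fps[of K F] by auto
  then show ?thesis
    using Suc by (simp add: l1_norm_altdef[of _ K'] lessThan_Suc_atMost)
qed simp

section \<open>Truncating a power series multiplied by a polynomial\<close>

lemma fps_pCons_mult:
  fixes F :: "complex fps"
  shows "fps_of_poly (pCons s S) * F = fps_const s * F + fps_X * (fps_of_poly S * F)"
  by (simp only: fps_of_poly_pCons ring_distribs mult.assoc mult.left_commute)

lemma fps_linear_mult_nth_Suc:
  fixes F :: "complex fps"
  shows "fps_nth (fps_of_poly [:s, t:] * F) (Suc k) = s * fps_nth F (Suc k) + t * fps_nth F k"
  unfolding fps_pCons_mult by simp

lemma fps_poly_mult_coeffs_tendsto_0:
  fixes F :: "complex fps"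
  assumes "fps_nth F \<longlonglongrightarrow> 0"
  shows "fps_nth (fps_of_poly S * F) \<longlonglongrightarrow> 0"
proof (induction S)
  case (pCons s S)
  have "(\<lambda>k. fps_nth (fps_X * (fps_of_poly S * F)) (Suc k)) \<longlonglongrightarrow> 0"
    using pCons by simp
  then have "(\<lambda>k. fps_nth (fps_X * (fps_of_poly S * F)) k) \<longlonglongrightarrow> 0"
    by (rule LIMSEQ_imp_Suc)
  then have "(\<lambda>k. s * fps_nth F k + fps_nth (fps_X * (fps_of_poly S * F)) k) \<longlonglongrightarrow> s * 0 + 0"
    using assms by (intro tendsto_intros)
  then show ?case
    unfolding fps_pCons_mult by simp
qed simp

lemma truncate_fps_X_mult:
  "truncate_fps (Suc K) (fps_X * H) = pCons 0 (truncate_fps (Suc K) H) - monom (fps_nth H K) (Suc K)"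
  for H :: "complex fps"
  by (rule poly_eqI) (auto simp: coeff_truncate_fps coeff_pCons split: nat.splits)

lemma truncate_fps_smult: "truncate_fps K (fps_const c * H) = Polynomial.smult c (truncate_fps K H)"
  for H :: "complex fps"
  by (rule poly_eqI) (auto simp: coeff_truncate_fps)

text \<open>Only coefficients straddling the cut are affected when truncation is exchanged with
  multiplication by \<open>S\<close>. Their number is bounded in terms of the degree of \<open>S\<close>, so the defect
  vanishes in the limit although it is measured in the \<open>l1\<close> norm. This lets an identity between
  power series be used for polynomials, which unlike series can be evaluated at a matrix
  without any convergence argument.\<close>
lemma truncate_fps_mult_defect_tendsto_0:
  fixes F :: "complex fps"
  assumes F: "fps_nth F \<longlonglongrightarrow> 0"
  shows "(\<lambda>K. l1_norm (S * truncate_fps K F - truncate_fps K (fps_of_poly S * F))) \<longlonglongrightarrow> 0"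
proof (rule LIMSEQ_imp_Suc, induction S)
  case (pCons s S)
  let ?H = "fps_of_poly S * F"
  let ?d = "\<lambda>K. S * truncate_fps (Suc K) F - truncate_fps (Suc K) ?H"
  have eq: "pCons s S * truncate_fps (Suc K) F - truncate_fps (Suc K) (fps_of_poly (pCons s S) * F)
      = pCons 0 (?d K) + monom (fps_nth ?H K) (Suc K)" for K
    unfolding fps_pCons_mult truncate_fps_add truncate_fps_smult truncate_fps_X_mult
    by simp
  have "(\<lambda>K. l1_norm (?d K) + cmod (fps_nth ?H K)) \<longlonglongrightarrow> 0 + cmod 0"
    by (intro tendsto_intros pCons fps_poly_mult_coeffs_tendsto_0 F)
  then have lim: "(\<lambda>K. l1_norm (?d K) + cmod (fps_nth ?H K)) \<longlonglongrightarrow> 0"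
    by simp
  show ?case
  proof (rule tendsto_sandwich[OF _ _ tendsto_const lim])
    show "\<forall>\<^sub>F K in sequentially. 0 \<le> l1_norm (pCons s S * truncate_fps (Suc K) F
        - truncate_fps (Suc K) (fps_of_poly (pCons s S) * F))"
      by (simp add: l1_norm_nonneg)
    show "\<forall>\<^sub>F K in sequentially. l1_norm (pCons s S * truncate_fps (Suc K) F
        - truncate_fps (Suc K) (fps_of_poly (pCons s S) * F)) \<le> l1_norm (?d K) + cmod (fps_nth ?H K)"
      unfolding eq
      by (intro always_eventually allI order_trans[OF l1_norm_add_le]) simp
  qed
qed simp

lemma truncate_fps_of_poly: "degree p < K \<Longrightarrow> truncate_fps K (fps_of_poly p) = p"
  by (rule poly_eqI) (auto simp: coeff_truncate_fps coeff_eq_0)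

section \<open>The difference quotient of a Blaschke product\<close>

text \<open>One Blaschke factor as a lossless filter: multiplication by the factor is an isometry of the
  Hardy space, and the functions \<open>c/(1 - b\<^sup>* z)\<close>, of squared norm \<open>|c|\<^sup>2/(1 - |b|\<^sup>2)\<close>, are
  orthogonal to its range. Both facts are contained in one conservation law for the unitary state
  space realization of the factor, and the law holds up to every finite time \<open>K\<close>, so no convergence
  has to be known in advance. The weights \<open>r ^ k\<close> transport this from the disk of radius \<open>r\<close>.\<close>
lemma allpass_section:
  fixes F :: "complex fps" and a c :: complex and r :: real
  assumes r: "0 < r" and ra: "r * cmod a < 1"
  obtains H :: "complex fps" where
    "fps_of_poly [:1, - (of_real r)\<^sup>2 * cnj a:] * H
       = fps_of_poly (Polynomial.smult (of_real r) [:-a, 1:]) * F + fps_const c"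
    "\<And>K. (\<Sum>k<K. (cmod (fps_nth H k) / r ^ k)\<^sup>2)
            \<le> (\<Sum>k<K. (cmod (fps_nth F k) / r ^ k)\<^sup>2) + (cmod c)\<^sup>2 / (1 - (r * cmod a)\<^sup>2)"
proof -
  define s where "s = sqrt (1 - (r * cmod a)\<^sup>2)"
  have "(r * cmod a)\<^sup>2 < 1"
    using r ra by (simp add: abs_square_less_1)
  then have s: "s > 0" and s2: "s\<^sup>2 = 1 - (r * cmod a)\<^sup>2"
    by (simp_all add: s_def)
  define b where "b = of_real r * a"
  have b2: "b * cnj b = of_real ((r * cmod a)\<^sup>2)"
    unfolding b_def power_mult_distrib of_real_mult complex_norm_square by (simp add: power2_eq_square algebra_simps)
  \<comment> \<open>The filter state, driven by \<open>F\<close>. Up to the scaling by \<open>r\<close>, the update matrix with rows \<open>(cnj b, s)\<close> and \<open>(s, -b)\<close> is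
      unitary, and the initial state produces the free response \<open>c/(1 - cnj b z)\<close>.\<close>
  define x where "x = rec_nat (c / of_real s)
     (\<lambda>k y. of_real r * (cnj b * y + of_real s * fps_nth F k))"
  have x0: "x 0 = c / of_real s" and
    xS: "x (Suc k) = of_real r * (cnj b * x k + of_real s * fps_nth F k)" for k
    by (simp_all add: x_def)
  define H where "H = Abs_fps (\<lambda>k. of_real s * x k - b * fps_nth F k)"
  have H: "fps_nth H k = of_real s * x k - b * fps_nth F k" for k
    by (simp add: H_def)
  have ss: "of_real s * of_real s = 1 - b * cnj b"
    unfolding b2 of_real_mult[symmetric] power2_eq_square[of s, symmetric] s2 by simp
  show ?thesis
  proof
    show "fps_of_poly [:1, - (of_real r)\<^sup>2 * cnj a:] * H
       = fps_of_poly (Polynomial.smult (of_real r) [:-a, 1:]) * F + fps_const c"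
    proof (rule fps_ext)
      fix k
      show "fps_nth (fps_of_poly [:1, - (of_real r)\<^sup>2 * cnj a:] * H) k
         = fps_nth (fps_of_poly (Polynomial.smult (of_real r) [:-a, 1:]) * F + fps_const c) k"
      proof (cases k)
        case 0
        then show ?thesis
          using s by (simp add: H x0 b_def)
      next
        case (Suc j)
        have "fps_nth H (Suc j) - (of_real r)\<^sup>2 * cnj a * fps_nth H j
            = of_real r * fps_nth F j - b * fps_nth F (Suc j)"
        proof -
          have "fps_nth H (Suc j) - (of_real r)\<^sup>2 * cnj a * fps_nth H j =
             of_real r * ((of_real s * of_real s) * fps_nth F j + cnj b * b * fps_nth F j)
             - b * fps_nth F (Suc j)"
            unfolding H xS b_def by (simp add: algebra_simps power2_eq_square)
          then show ?thesis
            unfolding ss by (simp add: algebra_simps)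
        qed
        then show ?thesis
          unfolding Suc fps_add_nth smult_pCons smult_0_right fps_linear_mult_nth_Suc by (simp add: b_def)
      qed
    qed
    have energy: "(cmod (x (Suc k)) / r ^ Suc k)\<^sup>2 + (cmod (fps_nth H k) / r ^ k)\<^sup>2
        = (cmod (x k) / r ^ k)\<^sup>2 + (cmod (fps_nth F k) / r ^ k)\<^sup>2" for k
    proof -
      let ?y = "x k" and ?g = "fps_nth F k"
      have "complex_of_real ((cmod (cnj b * ?y + of_real s * ?g))\<^sup>2
              + (cmod (of_real s * ?y - b * ?g))\<^sup>2)
          = (of_real s * of_real s + b * cnj b) * (?y * cnj ?y + ?g * cnj ?g)"
        unfolding of_real_add complex_norm_square by (simp add: algebra_simps)
      also have "\<dots> = complex_of_real ((cmod ?y)\<^sup>2 + (cmod ?g)\<^sup>2)"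
        unfolding ss of_real_add complex_norm_square by simp
      finally have "(cmod (cnj b * ?y + of_real s * ?g))\<^sup>2 + (cmod (fps_nth H k))\<^sup>2
          = (cmod ?y)\<^sup>2 + (cmod ?g)\<^sup>2"
        unfolding H of_real_eq_iff .
      moreover have "cmod (x (Suc k)) / r ^ Suc k = cmod (cnj b * ?y + of_real s * ?g) / r ^ k"
        unfolding xS using r by (simp add: norm_mult)
      ultimately show ?thesis
        by (simp add: power_divide add_divide_distrib[symmetric])
    qed
    have "(\<Sum>k<K. (cmod (fps_nth H k) / r ^ k)\<^sup>2) + (cmod (x K) / r ^ K)\<^sup>2
       = (\<Sum>k<K. (cmod (fps_nth F k) / r ^ k)\<^sup>2) + (cmod c)\<^sup>2 / s\<^sup>2" for K
    proof (induction K)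
      case 0
      show ?case using s by (simp add: x0 norm_divide power_divide)
    next
      case (Suc K)
      then show ?case using energy[of K] by simp
    qed
    then show "(\<Sum>k<K. (cmod (fps_nth H k) / r ^ k)\<^sup>2)
        \<le> (\<Sum>k<K. (cmod (fps_nth F k) / r ^ k)\<^sup>2) + (cmod c)\<^sup>2 / (1 - (r * cmod a)\<^sup>2)" for K
      unfolding s2[symmetric] by (smt (verit) zero_le_power2)
  qed
qed

text \<open>With \<open>b\<close> the factor of a new zero, the product rule
  \<open>(b B)(z) - (b B)(\<zeta>) = b(z) (B(z) - B(\<zeta>)) + B(\<zeta>) (b(z) - b(\<zeta>))\<close> shows that the difference quotient
  of \<open>b B\<close> is obtained from that of \<open>B\<close> by one all-pass section, because the difference quotient of
  \<open>b\<close> is a multiple of \<open>1/(1 - r\<^sup>2 a\<^sup>* z)\<close>. The energies add up to the stated bound exactly.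
  Denominators are cleared by \<open>q\<close> so that both sides of the identity are polynomials.\<close>
lemma blaschke_difference_quotient:
  fixes M :: "complex multiset" and \<zeta> :: complex and r :: real
  assumes r: "0 < r" "r < 1" and z: "cmod \<zeta> \<le> 1" and M: "\<forall>l\<in>#M. cmod l \<le> 1"
  defines "q \<equiv> \<lambda>M. \<Prod>l\<in>#M. [:1, - (of_real r)\<^sup>2 * cnj l:]"
    and "\<beta> \<equiv> \<lambda>M. \<Prod>l\<in>#M. of_real r * (\<zeta> - l) / (1 - (of_real r)\<^sup>2 * cnj l * \<zeta>)"
  shows "\<exists>F::complex fps. fps_of_poly (q M * [:-\<zeta>, 1:]) * F
      = fps_of_poly ((\<Prod>l\<in>#M. Polynomial.smult (of_real r) [:-l, 1:]) - Polynomial.smult (\<beta> M) (q M)) \<and>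
    (\<forall>K. (\<Sum>k<K. (cmod (fps_nth F k) / r ^ k)\<^sup>2) \<le> r\<^sup>2 * (1 - (cmod (\<beta> M))\<^sup>2) / (1 - (r * cmod \<zeta>)\<^sup>2))"
  using M
proof (induction M)
  case empty
  show ?case
    by (rule exI[of _ 0]) (simp add: q_def \<beta>_def)
next
  case (add a M)
  then obtain F :: "complex fps" where
    F: "fps_of_poly (q M * [:-\<zeta>, 1:]) * F
      = fps_of_poly ((\<Prod>l\<in>#M. Polynomial.smult (of_real r) [:-l, 1:]) - Polynomial.smult (\<beta> M) (q M))"
    and F_le: "\<And>K. (\<Sum>k<K. (cmod (fps_nth F k) / r ^ k)\<^sup>2) \<le> r\<^sup>2 * (1 - (cmod (\<beta> M))\<^sup>2) / (1 - (r * cmod \<zeta>)\<^sup>2)"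
    by auto
  let ?P = "\<Prod>l\<in>#M. Polynomial.smult (of_real r) [:-l, 1:]"
  let ?\<rho> = "(complex_of_real r)\<^sup>2"
  define D where "D = 1 - ?\<rho> * cnj a * \<zeta>"
  have a: "cmod a \<le> 1" using add by simp
  have ra: "r * cmod a < 1" and rz: "r * cmod \<zeta> < 1"
    using mult_left_mono[OF a, of r] mult_left_mono[OF z, of r] r by linarith+
  have "cmod (?\<rho> * cnj a * \<zeta>) = (r * cmod a) * (r * cmod \<zeta>)"
    using r by (simp add: norm_mult norm_power power2_eq_square)
  also have "\<dots> < 1 * 1"
    using ra rz r by (intro mult_strict_mono') auto
  finally have D0: "D \<noteq> 0"
    unfolding D_def by auto
  \<comment> \<open>\<open>\<beta> M\<close> times the numerator of the difference quotient of the factor with zero \<open>a\<close>.\<close>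
  define c where "c = \<beta> M * of_real r * (1 - ?\<rho> * (a * cnj a)) / D"
  obtain H :: "complex fps" where
    H: "fps_of_poly [:1, - ?\<rho> * cnj a:] * H
       = fps_of_poly (Polynomial.smult (of_real r) [:-a, 1:]) * F + fps_const c" and
    H_le: "\<And>K. (\<Sum>k<K. (cmod (fps_nth H k) / r ^ k)\<^sup>2)
            \<le> (\<Sum>k<K. (cmod (fps_nth F k) / r ^ k)\<^sup>2) + (cmod c)\<^sup>2 / (1 - (r * cmod a)\<^sup>2)"
    using allpass_section[OF r(1) ra] by blast
  have \<beta>': "\<beta> (add_mset a M) = of_real r * (\<zeta> - a) / D * \<beta> M"
    by (simp add: \<beta>_def D_def)
  have q': "q (add_mset a M) = [:1, - ?\<rho> * cnj a:] * q M"
    by (simp add: q_def)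
  have lin: "Polynomial.smult c [:-\<zeta>, 1:] - Polynomial.smult (\<beta> M) (Polynomial.smult (of_real r) [:-a, 1:])
       = - Polynomial.smult (\<beta> (add_mset a M)) [:1, - ?\<rho> * cnj a:]"
    unfolding \<beta>' c_def using D0 by (simp add: field_simps) (simp add: D_def algebra_simps power2_eq_square)
  have regroup: "x * (P - Polynomial.smult b y) + y * Polynomial.smult c w
      = x * P + y * (Polynomial.smult c w - Polynomial.smult b x)" for x y w P :: "complex poly" and b
    by (simp add: algebra_simps)
  have "fps_of_poly (q (add_mset a M) * [:-\<zeta>, 1:]) * H
      = fps_of_poly (q M * [:-\<zeta>, 1:]) * (fps_of_poly [:1, - ?\<rho> * cnj a:] * H)"
    unfolding q' fps_of_poly_mult by (simp only: mult_ac)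
  also have "\<dots> = fps_of_poly (Polynomial.smult (of_real r) [:-a, 1:]) * (fps_of_poly (q M * [:-\<zeta>, 1:]) * F)
        + fps_of_poly (q M * [:-\<zeta>, 1:]) * fps_const c"
    unfolding H by (simp only: ring_distribs mult_ac)
  also have "\<dots> = fps_of_poly (Polynomial.smult (of_real r) [:-a, 1:] * (?P - Polynomial.smult (\<beta> M) (q M))
        + q M * Polynomial.smult c [:-\<zeta>, 1:])"
    unfolding F fps_of_poly_const[symmetric] fps_of_poly_mult[symmetric] fps_of_poly_add[symmetric]
      fps_of_poly_eq_iff by (simp add: smult_diff_right)
  also have "Polynomial.smult (of_real r) [:-a, 1:] * (?P - Polynomial.smult (\<beta> M) (q M))
        + q M * Polynomial.smult c [:-\<zeta>, 1:]
      = Polynomial.smult (of_real r) [:-a, 1:] * ?P + q M *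
         (Polynomial.smult c [:-\<zeta>, 1:] - Polynomial.smult (\<beta> M) (Polynomial.smult (of_real r) [:-a, 1:]))"
    by (rule regroup)
  also have "\<dots> = (\<Prod>l\<in>#add_mset a M. Polynomial.smult (of_real r) [:-l, 1:])
       - Polynomial.smult (\<beta> (add_mset a M)) (q (add_mset a M))"
    unfolding lin q' by (simp only: mult_smult_left mult_smult_right mult_minus_right
       image_mset_add_mset prod_mset.add_mset mult.commute[of "q M"] add_uminus_conv_diff)
  finally have eq: "fps_of_poly (q (add_mset a M) * [:-\<zeta>, 1:]) * H
      = fps_of_poly ((\<Prod>l\<in>#add_mset a M. Polynomial.smult (of_real r) [:-l, 1:])
       - Polynomial.smult (\<beta> (add_mset a M)) (q (add_mset a M)))"
    .
  have pos: "1 - (r * cmod a)\<^sup>2 > 0" "1 - (r * cmod \<zeta>)\<^sup>2 > 0"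
    using ra rz r by (simp_all add: abs_square_less_1)
  have cz: "(cmod D)\<^sup>2 - r\<^sup>2 * (cmod (\<zeta> - a))\<^sup>2 = (1 - (r * cmod a)\<^sup>2) * (1 - (r * cmod \<zeta>)\<^sup>2)"
  proof -
    have "complex_of_real ((cmod D)\<^sup>2 - r\<^sup>2 * (cmod (\<zeta> - a))\<^sup>2)
        = complex_of_real ((1 - (r * cmod a)\<^sup>2) * (1 - (r * cmod \<zeta>)\<^sup>2))"
      unfolding power_mult_distrib of_real_diff of_real_mult of_real_1 complex_norm_square D_def
      by (simp add: algebra_simps power2_eq_square)
    then show ?thesis unfolding of_real_eq_iff .
  qed
  have "(1 - (cmod (\<beta> M))\<^sup>2) * r\<^sup>2 / (1 - (r * cmod \<zeta>)\<^sup>2) + (cmod c)\<^sup>2 / (1 - (r * cmod a)\<^sup>2)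
      = r\<^sup>2 * (1 - (cmod (\<beta> (add_mset a M)))\<^sup>2) / (1 - (r * cmod \<zeta>)\<^sup>2)"
  proof -
    have nb: "cmod (\<beta> (add_mset a M)) = r * cmod (\<zeta> - a) / cmod D * cmod (\<beta> M)"
      unfolding \<beta>' using r by (simp only: norm_mult norm_divide norm_of_real abs_of_pos)
    have "1 - ?\<rho> * (a * cnj a) = complex_of_real (1 - (r * cmod a)\<^sup>2)"
      unfolding power_mult_distrib of_real_diff of_real_mult of_real_1 complex_norm_square by simp
    then have "cmod c = cmod (\<beta> M) * r * (1 - (r * cmod a)\<^sup>2) / cmod D"
      unfolding c_def using pos r by (simp only: norm_mult norm_divide norm_of_real abs_of_pos)
    then have "(cmod c)\<^sup>2 / (1 - (r * cmod a)\<^sup>2)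
         = (cmod (\<beta> M))\<^sup>2 * r\<^sup>2 * (1 - (r * cmod a)\<^sup>2) / (cmod D)\<^sup>2"
      using pos(1) by (simp add: power_mult_distrib power_divide) (simp add: power2_eq_square)
    also have "\<dots> = (cmod (\<beta> M))\<^sup>2 * r\<^sup>2 * ((cmod D)\<^sup>2 - r\<^sup>2 * (cmod (\<zeta> - a))\<^sup>2) / (cmod D)\<^sup>2 / (1 - (r * cmod \<zeta>)\<^sup>2)"
      unfolding cz using pos by simp
    also have "\<dots> = r\<^sup>2 * ((cmod (\<beta> M))\<^sup>2 - (cmod (\<beta> (add_mset a M)))\<^sup>2) / (1 - (r * cmod \<zeta>)\<^sup>2)"
      unfolding nb using D0
      by (simp add: power_mult_distrib power_divide right_diff_distrib diff_divide_distrib mult_ac)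
    finally show ?thesis
      by (simp add: add_divide_distrib[symmetric] algebra_simps)
  qed
  then have "(\<Sum>k<K. (cmod (fps_nth H k) / r ^ k)\<^sup>2)
      \<le> r\<^sup>2 * (1 - (cmod (\<beta> (add_mset a M)))\<^sup>2) / (1 - (r * cmod \<zeta>)\<^sup>2)" for K
    using order_trans[OF H_le[of K] add_right_mono[OF F_le[of K]]] by (simp add: mult.commute)
  with eq show ?case by blast
qed

section \<open>Norms on a quotient of the polynomial ring\<close>

lemma sum_power_le_inverse:
  fixes x :: real
  assumes "0 \<le> x" "x < 1"
  shows "(\<Sum>k<K. x ^ k) \<le> 1 / (1 - x)"
  using assms by (auto simp: sum_gp_strict intro: divide_right_mono)

lemma inverse_modulo_poly:
  fixes p m :: "complex poly"
  assumes "m \<noteq> 0" and no_root: "\<And>x. poly m x = 0 \<Longrightarrow> poly p x \<noteq> 0"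
  obtains v where "m dvd p * v - 1"
proof -
  have "degree (gcd p m) = 0"
  proof (rule ccontr)
    assume "degree (gcd p m) \<noteq> 0"
    then obtain x where "poly (gcd p m) x = 0"
      using fundamental_theorem_of_algebra[of "gcd p m"] by (auto simp: constant_degree)
    then have "poly p x = 0" "poly m x = 0"
      by (meson dvd_trans gcd_dvd1 gcd_dvd2 poly_eq_0_iff_dvd)+
    with no_root show False by blast
  qed
  moreover have "gcd p m \<noteq> 0" using \<open>m \<noteq> 0\<close> by simp
  ultimately have "is_unit (gcd p m)"
    by (rule is_unit_iff_degree[THEN iffD2, rotated])
  then have "gcd p m = 1"
    using coprime_imp_gcd_eq_1 is_unit_gcd by blast
  then have "fst (bezout_coefficients p m) * p + snd (bezout_coefficients p m) * m = 1"
    by (simp add: bezout_coefficients_fst_snd)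
  then have "p * fst (bezout_coefficients p m) - 1 = m * - snd (bezout_coefficients p m)"
    by (simp add: algebra_simps)
  then show ?thesis using that dvd_triv_left by metis
qed

text \<open>The norm \<open>\<psi>\<close> on \<open>\<complex>[X]/(m)\<close> is given as a seminorm on polynomials with kernel \<open>(m)\<close>. The
  uniform bound on the powers of \<open>X\<close> is the only link between \<open>\<psi>\<close> and multiplication.\<close>
locale quotient_norm =
  fixes m :: "complex poly" and \<psi> :: "complex poly \<Rightarrow> real" and C :: real
  assumes modulus_nonzero: "m \<noteq> 0"
    and eq_0_iff: "\<psi> p = 0 \<longleftrightarrow> m dvd p"
    and smult: "\<psi> (Polynomial.smult c p) = cmod c * \<psi> p"
    and triangle: "\<psi> (p + q) \<le> \<psi> p + \<psi> q"
    and power_le: "\<psi> (monom 1 k) \<le> C"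
begin

lemma nonneg: "0 \<le> \<psi> p"
proof -
  have "0 = \<psi> (p + Polynomial.smult (-1) p)"
    by (simp add: eq_0_iff)
  also have "\<dots> \<le> \<psi> p + \<psi> p"
    using triangle[of p "Polynomial.smult (-1) p"] unfolding smult norm_minus_cancel norm_one
      mult_1_left .
  finally show ?thesis by simp
qed

lemma bound_nonneg: "0 \<le> C"
  using nonneg power_le order_trans by blast

lemma cong_le: "m dvd p - q \<Longrightarrow> \<psi> p \<le> \<psi> q"
  using triangle[of "p - q" q] eq_0_iff[of "p - q"] by (metis add_0 diff_add_cancel)

lemma le_l1_norm: "\<psi> p \<le> C * l1_norm p"
proof -
  have "\<psi> (monom 1 k * p) \<le> C * l1_norm p" for k
  proof (induction p arbitrary: k)
    case 0
    show ?case using eq_0_iff[of 0] by simp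
  next
    case (pCons a p)
    have "monom 1 k * pCons a p = Polynomial.smult a (monom 1 k) + monom 1 (Suc k) * p"
      by (simp add: monom_Suc)
    then have "\<psi> (monom 1 k * pCons a p) \<le> \<psi> (Polynomial.smult a (monom 1 k)) + \<psi> (monom 1 (Suc k) * p)"
      using triangle by simp
    also have "\<dots> \<le> cmod a * C + C * l1_norm p"
      unfolding smult by (intro add_mono mult_left_mono power_le pCons) auto
    finally show ?case by (simp add: algebra_simps)
  qed
  from this[of 0] show ?thesis by (simp add: monom_0)
qed

text \<open>The cofactor \<open>p\<close> of \<open>X - l\<close> is an eigenvector of multiplication by \<open>X\<close> on the quotient, so
  \<open>|l|^k \<psi> p = \<psi> (X^k p)\<close> stays bounded.\<close>
lemma root_norm_le_1:
  assumes "poly m l = 0"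
  shows "cmod l \<le> 1"
proof (rule ccontr)
  assume "\<not> cmod l \<le> 1"
  obtain p where p: "m = [:-l, 1:] * p"
    using assms poly_eq_0_iff_dvd by (metis dvdE)
  with modulus_nonzero have "p \<noteq> 0" by auto
  then have "degree p < degree m"
    unfolding p by (subst degree_mult_eq) auto
  then have "\<not> m dvd p"
    using \<open>p \<noteq> 0\<close> by (auto dest: dvd_imp_degree_le)
  then have pos: "\<psi> p > 0"
    using nonneg[of p] eq_0_iff[of p] by linarith
  have power_cong: "m dvd Polynomial.smult (l ^ k) p - monom 1 k * p" for k
  proof (induction k)
    case 0
    show ?case by (simp add: monom_0)
  next
    case (Suc k)
    have "Polynomial.smult (l ^ Suc k) p - monom 1 (Suc k) * p
        = [:0, 1:] * (Polynomial.smult (l ^ k) p - monom 1 k * p) - Polynomial.smult (l ^ k) m"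
      unfolding p by (simp add: monom_Suc algebra_simps smult_add_right smult_diff_right)
    then show ?case
      using Suc by (metis dvd_diff dvd_mult dvd_refl dvd_smult)
  qed
  obtain k where k: "C * l1_norm p / \<psi> p < cmod l ^ k"
    using real_arch_pow[of "cmod l"] \<open>\<not> cmod l \<le> 1\<close> by auto
  have "cmod l ^ k * \<psi> p = \<psi> (Polynomial.smult (l ^ k) p)"
    by (simp add: smult norm_power)
  also have "\<dots> \<le> \<psi> (monom 1 k * p)"
    using power_cong by (rule cong_le)
  also have "\<dots> \<le> C * l1_norm p"
    using le_l1_norm[of "monom 1 k * p"] by simp
  finally show False
    using k pos by (simp add: field_simps)
qed

text \<open>The error is measured by \<open>l1_norm\<close>, not by \<open>\<psi>\<close>: this is what survives multiplication by a fixed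
  polynomial.\<close>
lemma le_of_approximants:
  assumes cong: "\<forall>\<^sub>F K in sequentially. m dvd p - (G K + e K)"
    and G: "\<And>K. l1_norm (G K) \<le> B"
    and e: "(\<lambda>K. l1_norm (e K)) \<longlonglongrightarrow> 0"
  shows "\<psi> p \<le> C * B"
proof (rule tendsto_lowerbound)
  have "(\<lambda>K. C * B + C * l1_norm (e K)) \<longlonglongrightarrow> C * B + C * 0"
    by (intro tendsto_intros e)
  then show "(\<lambda>K. C * B + C * l1_norm (e K)) \<longlonglongrightarrow> C * B"
    by simp
  show "\<forall>\<^sub>F K in sequentially. \<psi> p \<le> C * B + C * l1_norm (e K)"
    using cong
  proof eventually_elim
    case (elim K)
    have "\<psi> p \<le> \<psi> (G K) + \<psi> (e K)"
      using cong_le[OF elim] triangle order_trans by blast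
    also have "\<dots> \<le> C * l1_norm (G K) + C * l1_norm (e K)"
      by (intro add_mono le_l1_norm)
    finally show ?case
      using mult_left_mono[OF G bound_nonneg, of K] by simp
  qed
qed simp

text \<open>Partial sums of the Neumann series.\<close>
lemma resolvent_le_outside:
  assumes z: "cmod \<zeta> > 1" and u: "m dvd [:\<zeta>, -1:] * u - 1"
  shows "\<psi> u \<le> C / (cmod \<zeta> - 1)"
proof -
  have "\<zeta> \<noteq> 0" using z by auto
  define G where "G K = truncate_fps K (Abs_fps (\<lambda>k. inverse \<zeta> ^ Suc k))" for K
  have G: "[:\<zeta>, -1:] * G K = 1 - monom (inverse \<zeta> ^ K) K" for K
  proof (rule poly_eqI)
    fix k
    show "coeff ([:\<zeta>, -1:] * G K) k = coeff (1 - monom (inverse \<zeta> ^ K) K) k"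
      using \<open>\<zeta> \<noteq> 0\<close>
      by (cases k) (auto simp: G_def coeff_truncate_fps coeff_pCons less_Suc_eq)
  qed
  have "\<psi> u \<le> C * (1 / (cmod \<zeta> - 1))"
  proof (rule le_of_approximants)
    show "\<forall>\<^sub>F K in sequentially. m dvd u - (G K + monom (inverse \<zeta> ^ K) K * u)"
    proof (intro always_eventually allI)
      fix K
      have "u - (G K + monom (inverse \<zeta> ^ K) K * u) = ([:\<zeta>, -1:] * G K) * u - G K"
        unfolding G by (simp add: algebra_simps)
      also have "\<dots> = ([:\<zeta>, -1:] * u - 1) * G K"
        by (simp only: ring_distribs mult_ac mult_1_left)
      finally show "m dvd u - (G K + monom (inverse \<zeta> ^ K) K * u)"
        using u by (simp only: dvd_mult2)
    qed
    show "l1_norm (G K) \<le> 1 / (cmod \<zeta> - 1)" for K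
    proof -
      have l1: "l1_norm (G K) = inverse (cmod \<zeta>) * (\<Sum>k<K. inverse (cmod \<zeta>) ^ k)"
        unfolding G_def l1_norm_truncate_fps
        by (simp add: norm_mult norm_power norm_inverse sum_distrib_left)
      have "\<dots> \<le> inverse (cmod \<zeta>) * (1 / (1 - inverse (cmod \<zeta>)))"
        using z by (intro mult_left_mono sum_power_le_inverse) (auto simp: inverse_less_1_iff)
      also have "\<dots> = 1 / (cmod \<zeta> - 1)"
        using z \<open>\<zeta> \<noteq> 0\<close> by (simp add: field_simps)
      finally show ?thesis
        unfolding l1 .
    qed
    have "(\<lambda>K. inverse (cmod \<zeta>) ^ K) \<longlonglongrightarrow> 0"
      using z by (intro LIMSEQ_power_zero) (auto simp: inverse_less_1_iff)
    from tendsto_mult_left_zero[OF this]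
    show "(\<lambda>K. l1_norm (monom (inverse \<zeta> ^ K) K * u)) \<longlonglongrightarrow> 0"
      by (simp add: norm_power norm_inverse)
  qed
  then show ?thesis by simp
qed

text \<open>Modulo \<open>m\<close> the hypothesis says that \<open>F = \<beta>/(\<zeta> - X)\<close>, that is \<open>F = \<beta> u\<close>. Truncating \<open>F\<close>
  leaves a small error in the equation multiplied by \<open>q (X - \<zeta>)\<close>; since this polynomial has no
  root in common with \<open>m\<close>, it has an inverse \<open>v\<close> modulo \<open>m\<close>, by which the equation is solved for the
  truncation itself.\<close>
lemma resolvent_le_interpolant:
  fixes F :: "complex fps"
  assumes F: "fps_of_poly (q * [:-\<zeta>, 1:]) * F
      = fps_of_poly (Polynomial.smult c m - Polynomial.smult \<beta> q)"
    and F_le: "\<And>K. (\<Sum>k<K. cmod (fps_nth F k)) \<le> B"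
    and no_root: "\<And>x. poly m x = 0 \<Longrightarrow> poly q x \<noteq> 0 \<and> x \<noteq> \<zeta>"
    and u: "m dvd [:\<zeta>, -1:] * u - 1"
  shows "cmod \<beta> * \<psi> u \<le> C * B"
proof -
  define S where "S = q * [:-\<zeta>, 1:]"
  define T where "T = Polynomial.smult c m - Polynomial.smult \<beta> q"
  obtain v where v: "m dvd S * v - 1"
    by (rule inverse_modulo_poly[OF modulus_nonzero, of S]) (use no_root in \<open>auto simp: S_def\<close>)
  define e where "e K = S * truncate_fps K F - truncate_fps K (fps_of_poly S * F)" for K
  have "summable (\<lambda>k. cmod (fps_nth F k))"
    by (rule summableI_nonneg_bounded[OF _ F_le]) simp
  then have "fps_nth F \<longlonglongrightarrow> 0"
    using summable_LIMSEQ_zero tendsto_norm_zero_iff by blast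
  then have e: "(\<lambda>K. l1_norm (e K)) \<longlonglongrightarrow> 0"
    unfolding e_def by (rule truncate_fps_mult_defect_tendsto_0)
  have "\<psi> (Polynomial.smult \<beta> u) \<le> C * B"
  proof (rule le_of_approximants)
    show "\<forall>\<^sub>F K in sequentially. m dvd Polynomial.smult \<beta> u - (truncate_fps K F + (- v) * e K)"
      using eventually_gt_at_top[of "degree T"]
    proof eventually_elim
      case (elim K)
      let ?G = "truncate_fps K F"
      have eK: "e K = S * ?G - ([:c:] * m - [:\<beta>:] * q)"
        unfolding e_def using F[folded S_def T_def] truncate_fps_of_poly[OF elim]
        by (simp add: T_def)
      obtain a where a: "S * v - 1 = m * a" using v by (rule dvdE)
      obtain b where b: "[:\<zeta>, -1:] * u - 1 = m * b" using u by (rule dvdE)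
      define L where "L = [:\<zeta>, -1:]"
      have S: "S = - (q * L)"
        by (simp add: S_def L_def)
      have regroup: "g * u - (G + (- v) * (S * G - (c * m - g * q))) - m * (a * G - g * (a * u + b * q * v) - v * c)
          = (S * v - 1 - m * a) * G + g * (u + q * v + (m * a) * u + (m * b) * q * v)"
        for g u G v S c m q a b :: "complex poly"
        by (simp add: algebra_simps)
      have cancel: "u + q * v + (- (q * L) * v - 1) * u + (L * u - 1) * q * v = 0"
        for u q v L :: "complex poly"
        by (simp add: algebra_simps)
      have "[:\<beta>:] * u - (?G + (- v) * e K)
          = m * (a * ?G - [:\<beta>:] * (a * u + b * q * v) - v * [:c:])"
      proof -
        have "[:\<beta>:] * u - (?G + (- v) * e K) - m * (a * ?G - [:\<beta>:] * (a * u + b * q * v) - v * [:c:])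
          = (S * v - 1 - m * a) * ?G + [:\<beta>:] * (u + q * v + (m * a) * u + (m * b) * q * v)"
          unfolding eK by (rule regroup)
        also have "u + q * v + (m * a) * u + (m * b) * q * v = 0"
          unfolding a[symmetric] b[symmetric] L_def[symmetric] S by (rule cancel)
        finally show ?thesis using a by simp
      qed
      then show ?case by simp
    qed
    show "l1_norm (truncate_fps K F) \<le> B" for K
      unfolding l1_norm_truncate_fps by (rule F_le)
    have lim: "(\<lambda>K. l1_norm (- v) * l1_norm (e K)) \<longlonglongrightarrow> 0"
      using e by (rule tendsto_mult_right_zero)
    show "(\<lambda>K. l1_norm ((- v) * e K)) \<longlonglongrightarrow> 0"
      by (rule tendsto_sandwich[OF _ _ tendsto_const lim]; intro always_eventually allI l1_norm_nonneg l1_norm_mult_le)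
  qed
  then show ?thesis by (simp add: smult)
qed

lemma resolvent_le_blaschke:
  fixes r :: real
  assumes m: "m = (\<Prod>l\<in>#M. [:-l, 1:])"
    and z: "cmod \<zeta> \<le> 1" "poly m \<zeta> \<noteq> 0" and r: "0 < r" "r < 1"
    and u: "m dvd [:\<zeta>, -1:] * u - 1"
  defines "\<beta> \<equiv> \<Prod>l\<in>#M. of_real r * (\<zeta> - l) / (1 - (of_real r)\<^sup>2 * cnj l * \<zeta>)"
  shows "cmod \<beta> * \<psi> u \<le> C * sqrt (1 / (1 - r\<^sup>2) * (r\<^sup>2 * (1 - (cmod \<beta>)\<^sup>2) / (1 - (r * cmod \<zeta>)\<^sup>2)))"
proof -
  define q where "q = (\<Prod>l\<in>#M. [:1, - (of_real r)\<^sup>2 * cnj l:])"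
  have M: "cmod l \<le> 1" if "l \<in># M" for l
    using that by (intro root_norm_le_1) (auto simp: m poly_prod_mset prod_mset_zero_iff)
  have prod: "(\<Prod>l\<in>#M. Polynomial.smult (of_real r) [:-l, 1:]) = Polynomial.smult (of_real r ^ size M) m"
    unfolding m
  proof (induction M)
    case (add x M)
    have "(\<Prod>l\<in>#add_mset x M. Polynomial.smult (of_real r) [:-l, 1:])
        = Polynomial.smult (of_real r) [:-x, 1:] * Polynomial.smult (of_real r ^ size M) (\<Prod>l\<in>#M. [:-l, 1:])"
      unfolding add.IH[symmetric] by simp
    also have "\<dots> = Polynomial.smult (of_real r ^ size (add_mset x M)) ([:-x, 1:] * (\<Prod>l\<in>#M. [:-l, 1:]))"
      by (simp only: mult_smult_left mult_smult_right smult_smult size_add_mset power_Suc mult.commute[of "complex_of_real r"])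
    finally show ?case by simp
  qed simp
  obtain F :: "complex fps" where
    F: "fps_of_poly (q * [:-\<zeta>, 1:]) * F
      = fps_of_poly (Polynomial.smult (of_real r ^ size M) m - Polynomial.smult \<beta> q)"
    and F_le: "\<And>K. (\<Sum>k<K. (cmod (fps_nth F k) / r ^ k)\<^sup>2)
         \<le> r\<^sup>2 * (1 - (cmod \<beta>)\<^sup>2) / (1 - (r * cmod \<zeta>)\<^sup>2)"
    using blaschke_difference_quotient[OF r z(1), of M] M unfolding prod q_def \<beta>_def by blast
  show ?thesis
  proof (rule resolvent_le_interpolant[OF F _ _ u])
    fix K
    have r2: "r\<^sup>2 < 1" using r by (simp add: abs_square_less_1)
    have "(\<Sum>k<K. cmod (fps_nth F k)) = (\<Sum>k<K. r ^ k * (cmod (fps_nth F k) / r ^ k))"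
      using r by simp
    also have "\<dots> \<le> sqrt ((\<Sum>k<K. (r ^ k)\<^sup>2) * (\<Sum>k<K. (cmod (fps_nth F k) / r ^ k)\<^sup>2))"
      by (intro real_le_rsqrt Cauchy_Schwarz_ineq_sum)
    also have "\<dots> \<le> sqrt (1 / (1 - r\<^sup>2) * (r\<^sup>2 * (1 - (cmod \<beta>)\<^sup>2) / (1 - (r * cmod \<zeta>)\<^sup>2)))"
    proof (intro real_sqrt_le_mono mult_mono F_le)
      show "(\<Sum>k<K. (r ^ k)\<^sup>2) \<le> 1 / (1 - r\<^sup>2)"
        using sum_power_le_inverse[of "r\<^sup>2" K] r2 by (simp add: power_mult[symmetric] mult.commute)
    qed (use r2 in \<open>auto intro!: sum_nonneg\<close>)
    finally show "(\<Sum>k<K. cmod (fps_nth F k))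
      \<le> sqrt (1 / (1 - r\<^sup>2) * (r\<^sup>2 * (1 - (cmod \<beta>)\<^sup>2) / (1 - (r * cmod \<zeta>)\<^sup>2)))" .
  next
    fix x assume x: "poly m x = 0"
    then have "cmod x \<le> 1" by (rule root_norm_le_1)
    have "1 - (of_real r)\<^sup>2 * cnj l * x \<noteq> 0" if "l \<in># M" for l
    proof -
      have "cmod ((of_real r)\<^sup>2 * cnj l * x) \<le> r\<^sup>2 * 1 * 1"
        unfolding norm_mult using M[OF that] \<open>cmod x \<le> 1\<close>
        by (intro mult_mono) (auto simp: norm_power)
      also have "\<dots> < 1" using r by (simp add: abs_square_less_1)
      finally show ?thesis by auto
    qed
    then show "poly q x \<noteq> 0 \<and> x \<noteq> \<zeta>"
      using x z by (auto simp: q_def poly_prod_mset prod_mset_zero_iff algebra_simps)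
  qed
qed

end

section \<open>The choice of the radius\<close>

lemma blaschke_factor_norm:
  fixes a z :: complex
  shows "(cmod (1 - cnj a * z))\<^sup>2 - (cmod (z - a))\<^sup>2 = (1 - (cmod a)\<^sup>2) * (1 - (cmod z)\<^sup>2)"
proof -
  have "complex_of_real ((cmod (1 - cnj a * z))\<^sup>2 - (cmod (z - a))\<^sup>2)
      = complex_of_real ((1 - (cmod a)\<^sup>2) * (1 - (cmod z)\<^sup>2))"
    unfolding of_real_diff of_real_mult of_real_1 complex_norm_square
    by (simp add: algebra_simps)
  then show ?thesis unfolding of_real_eq_iff .
qed

lemma norm_prod_mset_le:
  fixes f g :: "'a \<Rightarrow> complex"
  assumes "\<And>l. l \<in># M \<Longrightarrow> cmod (f l) \<le> k * cmod (g l)"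
  shows "cmod (\<Prod>l\<in>#M. f l) \<le> k ^ size M * cmod (\<Prod>l\<in>#M. g l)"
  using assms
proof (induction M)
  case (add a M)
  have "cmod (f a) * cmod (\<Prod>l\<in>#M. f l) \<le> (k * cmod (g a)) * (k ^ size M * cmod (\<Prod>l\<in>#M. g l))"
    using add by (intro mult_mono add.IH) (auto intro: order_trans[OF norm_ge_zero])
  then show ?case
    by (simp add: norm_mult mult_ac)
qed simp

text \<open>The convex function \<open>4 powr (-x)\<close> lies below its chord \<open>1 - x\<close> on \<open>[0, 1/2]\<close>.\<close>
lemma one_minus_power_ge_quarter:
  fixes x :: real
  assumes "0 \<le> x" "x \<le> 1 / 2" "real d * x \<le> 1"
  shows "1 / 4 \<le> (1 - x) ^ d"
proof -
  have "(1 / 2) powr (2 * x) \<le> 1 - x"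
    using Youngs_inequality_0[of "1 - 2 * x" "2 * x" 1 "1 / 2"] assms by simp
  then have "((1 / 2) powr (2 * x)) ^ d \<le> (1 - x) ^ d"
    by (intro power_mono) auto
  moreover have "((1 / 2 :: real) powr (2 * x)) ^ d = (1 / 2) powr (2 * (real d * x))"
    by (simp add: powr_realpow[symmetric] powr_powr mult_ac)
  moreover have "(1 / 2 :: real) powr 2 \<le> (1 / 2) powr (2 * (real d * x))"
    using assms by (intro powr_mono') auto
  ultimately show ?thesis
    by (simp add: power2_eq_square)
qed

text \<open>Factor by factor, \<open>|1 - r\<^sup>2 l\<^sup>* \<zeta>| \<le> |1 - l\<^sup>* \<zeta>| + (1 - r\<^sup>2) \<le> (1 + 1/(2d)) |1 - l\<^sup>* \<zeta>|\<close>. The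
  hypothesis of at least two zeros makes \<open>1 - r\<^sup>2\<close> at most \<open>1/2\<close>; as also \<open>d (1 - r\<^sup>2) \<le> 1\<close>,
  this gives \<open>r^(2d) \<ge> 1/4\<close>.\<close>
lemma blaschke_dilation_le:
  fixes M :: "complex multiset" and \<zeta> :: complex and \<mu> r :: real
  assumes M: "\<And>l. l \<in># M \<Longrightarrow> cmod l \<le> 1 \<and> \<mu> \<le> cmod (1 - cnj \<zeta> * l)"
    and z: "cmod \<zeta> \<le> 1" and \<mu>: "0 < \<mu>" "\<mu> \<le> 2" and d: "2 \<le> size M"
    and r: "0 < r" "r\<^sup>2 = 1 - \<mu> / (2 * real (size M))"
  shows "(cmod (\<Prod>l\<in>#M. (\<zeta> - l) / (1 - cnj l * \<zeta>)))\<^sup>2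
    \<le> 4 * exp 1 * (cmod (\<Prod>l\<in>#M. of_real r * (\<zeta> - l) / (1 - (of_real r)\<^sup>2 * cnj l * \<zeta>)))\<^sup>2"
proof -
  define d where "d = size M"
  have d2: "2 \<le> d" using d by (simp add: d_def)
  define x where "x = \<mu> / (2 * real d)"
  have x: "0 < x" "real d * x \<le> 1" "x / \<mu> = 1 / real (2 * d)"
    using \<mu> d2 by (auto simp: x_def field_simps)
  have "2 * x \<le> real d * x"
    using d2 x by (intro mult_right_mono) auto
  then have x2: "x \<le> 1 / 2" using x by linarith
  have r2: "r\<^sup>2 = 1 - x" using r by (simp add: x_def d_def)
  define h where "h = (1 + 1 / real (2 * d)) / r"
  have "cmod ((\<zeta> - l) / (1 - cnj l * \<zeta>))
      \<le> h * cmod (of_real r * (\<zeta> - l) / (1 - (of_real r)\<^sup>2 * cnj l * \<zeta>))" if l: "l \<in># M" for l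
  proof -
    let ?D = "1 - cnj l * \<zeta>" and ?E = "1 - (of_real r)\<^sup>2 * cnj l * \<zeta>"
    have "cmod ?D = cmod (cnj (1 - cnj \<zeta> * l))"
      by (simp add: mult.commute)
    then have D: "\<mu> \<le> cmod ?D"
      using M[OF l] by (simp only: complex_mod_cnj)
    have lz: "cmod (cnj l * \<zeta>) \<le> 1"
      using M[OF l] z mult_mono[of "cmod l" 1 "cmod \<zeta>" 1] by (simp add: norm_mult)
    have "?E = ?D + of_real x * (cnj l * \<zeta>)"
      unfolding of_real_power[symmetric] r2 by (simp add: algebra_simps)
    then have "cmod ?E \<le> cmod ?D + cmod (of_real x * (cnj l * \<zeta>))"
      using norm_triangle_ineq by metis
    also have "cmod (of_real x * (cnj l * \<zeta>)) \<le> x * 1"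
      unfolding norm_mult[of "of_real x"] using x lz by (intro mult_mono) auto
    also have "x * 1 \<le> x / \<mu> * cmod ?D"
      using mult_left_mono[OF D, of x] \<mu>(1) x(1)
      by (simp only: times_divide_eq_left pos_le_divide_eq mult_1_right less_imp_le)
    finally have E: "cmod ?E \<le> (1 + 1 / real (2 * d)) * cmod ?D"
      unfolding x by (simp add: algebra_simps)
    have eq: "cmod (of_real r * (\<zeta> - l) / ?E) * h = (1 + 1 / real (2 * d)) * (cmod (\<zeta> - l) / cmod ?E)"
      using r(1) by (simp add: norm_mult norm_divide h_def)
    have "cmod (\<zeta> - l) / cmod ?D \<le> (1 + 1 / real (2 * d)) * (cmod (\<zeta> - l) / cmod ?E)"
    proof -
      have "r\<^sup>2 * cmod (cnj l * \<zeta>) \<le> r\<^sup>2 * 1"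
        using lz by (intro mult_left_mono) auto
      also have "\<dots> < 1" using r2 x by simp
      finally have "cmod ((of_real r)\<^sup>2 * cnj l * \<zeta>) < 1"
        by (simp add: norm_mult norm_power mult.assoc)
      then have "?E \<noteq> 0" by auto
      then have "cmod ?E > 0" by simp
      moreover have "cmod ?D > 0" using D \<mu> by linarith
      ultimately have "cmod (\<zeta> - l) * cmod ?E \<le> cmod (\<zeta> - l) * ((1 + 1 / real (2 * d)) * cmod ?D)"
        using E by (intro mult_left_mono) auto
      then show ?thesis
        using \<open>cmod ?E > 0\<close> \<open>cmod ?D > 0\<close> by (simp add: divide_simps mult_ac)
    qed
    then show ?thesis
      unfolding norm_divide[of "\<zeta> - l" ?D] mult.commute[of h] eq .
  qed
  then have "cmod (\<Prod>l\<in>#M. (\<zeta> - l) / (1 - cnj l * \<zeta>))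
      \<le> h ^ d * cmod (\<Prod>l\<in>#M. of_real r * (\<zeta> - l) / (1 - (of_real r)\<^sup>2 * cnj l * \<zeta>))" (is "?b \<le> _ * ?\<beta>")
    unfolding d_def by (rule norm_prod_mset_le)
  then have "?b\<^sup>2 \<le> (h ^ d * ?\<beta>)\<^sup>2"
    by (intro power_mono) auto
  also have "\<dots> = h ^ (2 * d) * ?\<beta>\<^sup>2"
    by (simp add: power_mult_distrib power_mult[symmetric] mult.commute)
  also have "\<dots> \<le> (4 * exp 1) * ?\<beta>\<^sup>2"
  proof (intro mult_right_mono)
    have "h ^ (2 * d) = (1 + 1 / real (2 * d)) ^ (2 * d) / (1 - x) ^ d"
      unfolding h_def power_divide by (simp add: power_mult r2)
    also have "\<dots> \<le> exp 1 / (1 / 4)"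
      using exp_ge_one_plus_x_over_n_power_n[of "2 * d" 1] one_minus_power_ge_quarter[of x d] x x2 d2
      by (intro frac_le) auto
    finally show "h ^ (2 * d) \<le> 4 * exp 1" by simp
  qed simp
  finally show ?thesis .
qed

context quotient_norm
begin

text \<open>For at least two roots this is \<open>resolvent_le_blaschke\<close> at the radius \<open>r\<^sup>2 = 1 - \<mu>/(2d)\<close>. For a
  single root \<open>l\<close> the resolvent is the constant \<open>1/(\<zeta> - l)\<close> modulo \<open>m\<close>, and \<open>1 - |\<zeta>| \<le> \<mu>\<close> makes the
  denominator of the bound at most \<open>3\<mu>\<close>.\<close>
lemma resolvent_le_inside:
  assumes m: "m = (\<Prod>l\<in>#M. [:-l, 1:])" and M: "M \<noteq> {#}"
    and z: "cmod \<zeta> \<le> 1" "poly m \<zeta> \<noteq> 0"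
    and u: "m dvd [:\<zeta>, -1:] * u - 1"
    and \<mu>: "0 < \<mu>" "\<mu> \<le> 2" "1 - cmod \<zeta> \<le> \<mu>" "\<And>l. l \<in># M \<Longrightarrow> \<mu> \<le> cmod (1 - cnj \<zeta> * l)"
  defines "d \<equiv> real (size M)" and "b \<equiv> \<Prod>l\<in>#M. (\<zeta> - l) / (1 - cnj l * \<zeta>)"
  shows "\<psi> u \<le> 2 * d * C / (sqrt \<mu> * sqrt (2 * d - 2 * d * (cmod \<zeta>)\<^sup>2 + (cmod \<zeta>)\<^sup>2 * \<mu>))
           * sqrt (4 * exp 1 / (cmod b)\<^sup>2 - 1)"
proof -
  define t where "t = cmod \<zeta>"
  have t: "0 \<le> t" "t \<le> 1" using z by (auto simp: t_def)
  define W where "W = 2 * d - 2 * d * t\<^sup>2 + t\<^sup>2 * \<mu>"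
  have d: "1 \<le> d"
    using M unfolding d_def by (metis One_nat_def Suc_leI nonempty_has_size of_nat_1 of_nat_le_iff)
  have root: "cmod l \<le> 1" "\<zeta> \<noteq> l" "1 - cnj l * \<zeta> \<noteq> 0" if "l \<in># M" for l
  proof -
    have "poly m l = 0"
      using that unfolding m by (auto simp: poly_prod_mset prod_mset_zero_iff)
    then show "cmod l \<le> 1" "\<zeta> \<noteq> l" using z root_norm_le_1 by auto
    have "1 - cnj \<zeta> * l \<noteq> 0" using \<mu>(1) \<mu>(4)[OF that] by auto
    then have "cnj (1 - cnj \<zeta> * l) \<noteq> 0" by (simp only: complex_cnj_zero_iff not_False_eq_True)
    then show "1 - cnj l * \<zeta> \<noteq> 0" by (simp add: mult.commute)
  qed
  have t2: "t\<^sup>2 \<le> 1" using t by (simp add: power_le_one)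
  have W: "W > 0"
  proof (cases "t = 1")
    case True
    then show ?thesis using \<mu> by (simp add: W_def)
  next
    case False
    then have "t\<^sup>2 < 1" using t by (simp add: abs_square_less_1)
    then have "2 * d * (1 - t\<^sup>2) > 0" using d by simp
    moreover have "0 \<le> t\<^sup>2 * \<mu>" using \<mu> by simp
    ultimately show ?thesis by (simp add: W_def algebra_simps)
  qed
  have b1: "cmod b \<le> 1"
  proof -
    have "cmod ((\<zeta> - l) / (1 - cnj l * \<zeta>)) \<le> 1 * cmod 1" if l: "l \<in># M" for l
    proof -
      have "(cmod l)\<^sup>2 \<le> 1" "(cmod \<zeta>)\<^sup>2 \<le> 1"
        using root(1)[OF l] z(1) by (simp_all add: power_le_one)
      then have "0 \<le> (1 - (cmod l)\<^sup>2) * (1 - (cmod \<zeta>)\<^sup>2)"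
        by (intro mult_nonneg_nonneg) simp_all
      then have "(cmod (\<zeta> - l))\<^sup>2 \<le> (cmod (1 - cnj l * \<zeta>))\<^sup>2"
        unfolding blaschke_factor_norm[of l \<zeta>, symmetric] by linarith
      then have "cmod (\<zeta> - l) \<le> cmod (1 - cnj l * \<zeta>)"
        by (rule power2_le_imp_le) simp
      then show ?thesis using root(3)[OF l] by (simp add: norm_divide)
    qed
    then have "cmod b \<le> 1 ^ size M * cmod (\<Prod>l\<in>#M. 1)"
      unfolding b_def by (rule norm_prod_mset_le)
    then show ?thesis by simp
  qed
  consider (one) "size M = 1" | (many) "2 \<le> size M"
    using M nonempty_has_size[of M] by linarith
  then show ?thesis
  proof cases
    case one
    then obtain l where l: "M = {#l#}" using size_1_singleton_mset by blast
    then have m': "m = [:-l, 1:]" by (simp add: m)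
    define s where "s = cmod (\<zeta> - l)"
    define D where "D = cmod (1 - cnj l * \<zeta>)"
    have s: "s > 0" using root[of l] by (simp add: s_def l)
    have "D = cmod (cnj (1 - cnj \<zeta> * l))"
      by (simp add: D_def mult.commute)
    moreover have "\<mu> \<le> cmod (1 - cnj \<zeta> * l)"
      using \<mu>(4)[of l] by (simp add: l)
    ultimately have D: "\<mu> \<le> D"
      by (simp only: complex_mod_cnj)
    have "s / D \<le> 1"
      using b1 by (simp add: b_def l s_def D_def norm_divide)
    then have "s\<^sup>2 \<le> D\<^sup>2"
      using s D \<mu> by (intro power_mono) (auto simp: field_simps)
    then have Ds: "D\<^sup>2 / s\<^sup>2 \<ge> 1" using s by simp
    have "poly ([:\<zeta>, -1:] * u - 1) l = 0"
      using u unfolding m' by (simp only: poly_eq_0_iff_dvd)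
    then have "(\<zeta> - l) * poly u l = 1" by (simp add: algebra_simps)
    then have "poly u l = 1 / (\<zeta> - l)"
      using root[of l] by (simp add: field_simps l)
    then have "m dvd u - [:1 / (\<zeta> - l):]"
      unfolding m' poly_eq_0_iff_dvd[symmetric] by simp
    then have "\<psi> u \<le> \<psi> [:1 / (\<zeta> - l):]"
      by (rule cong_le)
    also have "\<dots> \<le> C * (1 / s)"
      using le_l1_norm[of "[:1 / (\<zeta> - l):]"] by (simp add: s_def norm_divide)
    also have "\<dots> \<le> C * (2 / (3 * \<mu>) * (2 * D / s))"
      using D \<mu> s by (intro mult_left_mono bound_nonneg) (simp add: field_simps)
    also have "\<dots> \<le> C * (2 / (sqrt \<mu> * sqrt W) * sqrt (4 * exp 1 / (cmod b)\<^sup>2 - 1))"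
    proof (intro mult_left_mono mult_mono bound_nonneg)
      \<comment> \<open>Here \<open>1 - t \<le> \<mu>\<close> gives \<open>W \<le> 5 \<mu>\<close>.\<close>
      have "W = 2 * ((1 + t) * (1 - t)) + t\<^sup>2 * \<mu>"
        by (simp add: W_def d_def one power2_eq_square algebra_simps)
      also have "\<dots> \<le> 2 * (2 * \<mu>) + 1 * \<mu>"
        using t t2 \<mu> by (intro add_mono mult_left_mono mult_mono) (auto simp: t_def)
      finally have "\<mu> * W \<le> (3 * \<mu>)\<^sup>2"
        using mult_left_mono[of W "5 * \<mu>" \<mu>] \<mu> by (simp add: power2_eq_square)
      then have "sqrt \<mu> * sqrt W \<le> 3 * \<mu>"
        unfolding real_sqrt_mult[symmetric] using \<mu> by (intro real_le_lsqrt) auto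
      then show "2 / (3 * \<mu>) \<le> 2 / (sqrt \<mu> * sqrt W)"
        using \<mu> W by (intro divide_left_mono) auto
      have "5 \<le> 4 * exp (1::real)"
        using exp_ge_add_one_self[of 1] by simp
      then have "5 * (D\<^sup>2 / s\<^sup>2) \<le> 4 * exp 1 * (D\<^sup>2 / s\<^sup>2)"
        using Ds by (intro mult_right_mono) auto
      then have "(2 * D / s)\<^sup>2 \<le> 4 * exp 1 / (s / D)\<^sup>2 - 1"
        using Ds by (simp add: power_divide power_mult_distrib)
      then show "2 * D / s \<le> sqrt (4 * exp 1 / (cmod b)\<^sup>2 - 1)"
        by (intro real_le_rsqrt) (simp add: b_def l norm_divide s_def D_def)
    qed (use \<mu> W s D in auto)
    finally show ?thesis
      by (simp add: W_def t_def d_def one mult_ac)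
  next
    case many
    define x where "x = \<mu> / (2 * d)"
    have x: "0 < x" "x < 1"
      using \<mu> many by (auto simp: x_def d_def field_simps)
    define r where "r = sqrt (1 - x)"
    have r: "0 < r" "r < 1" and r2: "r\<^sup>2 = 1 - x"
      using x by (auto simp: r_def)
    define \<beta> where "\<beta> = (\<Prod>l\<in>#M. of_real r * (\<zeta> - l) / (1 - (of_real r)\<^sup>2 * cnj l * \<zeta>))"
    have b_le: "(cmod b)\<^sup>2 \<le> 4 * exp 1 * (cmod \<beta>)\<^sup>2"
      unfolding b_def \<beta>_def
      by (rule blaschke_dilation_le[OF _ z(1) \<mu>(1,2) many r(1)])
         (use root \<mu>(4) r2 in \<open>auto simp: x_def d_def\<close>)
    have "b \<noteq> 0"
      using root unfolding b_def by (auto simp: prod_mset_zero_iff)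
    then have b: "cmod b > 0" by simp
    then have "0 < 4 * exp 1 * (cmod \<beta>)\<^sup>2"
      using b_le by (intro less_le_trans[OF _ b_le]) simp
    then have \<beta>: "cmod \<beta> > 0" by auto
    have e: "1 - (r * cmod \<zeta>)\<^sup>2 = W / (2 * d)"
      using d by (simp add: power_mult_distrib r2 W_def x_def t_def field_simps)
    have "1 / (1 - r\<^sup>2) * (r\<^sup>2 * (1 - (cmod \<beta>)\<^sup>2) / (1 - (r * cmod \<zeta>)\<^sup>2))
        = (cmod \<beta>)\<^sup>2 * (((2 * d)\<^sup>2 / (\<mu> * W)) * (r\<^sup>2 * (1 / (cmod \<beta>)\<^sup>2 - 1)))"
    proof -
      have "1 / (1 - r\<^sup>2) = 2 * d / \<mu>"
        by (simp add: r2 x_def)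
      moreover have "1 - (cmod \<beta>)\<^sup>2 = (cmod \<beta>)\<^sup>2 * (1 / (cmod \<beta>)\<^sup>2 - 1)"
        using \<beta> by (simp add: algebra_simps)
      moreover have "2 * d / \<mu> * (r\<^sup>2 * (B * Q) / (W / (2 * d))) = B * ((2 * d)\<^sup>2 / (\<mu> * W) * (r\<^sup>2 * Q))"
        for B Q :: real
        by (simp add: power2_eq_square)
      ultimately show ?thesis
        unfolding e by (simp only:)
    qed
    also have "\<dots> \<le> (cmod \<beta>)\<^sup>2 * (((2 * d)\<^sup>2 / (\<mu> * W)) * (4 * exp 1 / (cmod b)\<^sup>2 - 1))"
    proof (intro mult_left_mono)
      have "1 / (cmod \<beta>)\<^sup>2 \<le> 4 * exp 1 / (cmod b)\<^sup>2"
        using b_le b \<beta> by (simp add: field_simps)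
      then have "r\<^sup>2 * (1 / (cmod \<beta>)\<^sup>2 - 1) \<le> r\<^sup>2 * (4 * exp 1 / (cmod b)\<^sup>2 - 1)"
        by (intro mult_left_mono) auto
      also have "\<dots> \<le> 1 * (4 * exp 1 / (cmod b)\<^sup>2 - 1)"
      proof (intro mult_right_mono)
        have "(cmod b)\<^sup>2 \<le> 1" using b1 by (simp add: power_le_one)
        also have "1 \<le> 4 * exp (1::real)" using exp_ge_add_one_self[of 1] by simp
        finally show "0 \<le> 4 * exp 1 / (cmod b)\<^sup>2 - 1" using b by simp
      qed (use r2 x in simp)
      finally show "r\<^sup>2 * (1 / (cmod \<beta>)\<^sup>2 - 1) \<le> 4 * exp 1 / (cmod b)\<^sup>2 - 1"
        by simp
    qed (use \<mu> W in auto)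
    finally have "cmod \<beta> * \<psi> u
       \<le> C * sqrt ((cmod \<beta>)\<^sup>2 * (((2 * d)\<^sup>2 / (\<mu> * W)) * (4 * exp 1 / (cmod b)\<^sup>2 - 1)))"
      using resolvent_le_blaschke[OF m z r u] bound_nonneg
      unfolding \<beta>_def by (meson mult_left_mono order_trans real_sqrt_le_mono)
    also have "\<dots> = cmod \<beta> * (2 * d * C / (sqrt \<mu> * sqrt W) * sqrt (4 * exp 1 / (cmod b)\<^sup>2 - 1))"
      using \<beta> d by (simp add: real_sqrt_mult real_sqrt_divide)
    finally have "\<psi> u \<le> 2 * d * C / (sqrt \<mu> * sqrt W) * sqrt (4 * exp 1 / (cmod b)\<^sup>2 - 1)"
      using \<beta> by (simp only: mult_le_cancel_left_pos)
    then show ?thesis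
      by (simp add: W_def t_def)
  qed
qed

end

section \<open>Evaluating polynomials at a matrix\<close>

context
  fixes A :: "complex mat" and n :: nat
  assumes A: "A \<in> carrier_mat n n"
begin

lemma poly_at_mat_carrier [simp]: "poly_at_mat p A \<in> carrier_mat n n"
  using A by (simp add: poly_at_mat_def)

lemma poly_at_mat_index:
  assumes "degree p \<le> L" "i < n" "j < n"
  shows "poly_at_mat p A $$ (i, j) = (\<Sum>k\<le>L. coeff p k * (A ^\<^sub>m k) $$ (i, j))"
proof -
  have "poly_at_mat p A $$ (i, j) = (\<Sum>k\<le>degree p. coeff p k * (A ^\<^sub>m k) $$ (i, j))"
    using A assms by (simp add: poly_at_mat_def)
  also have "\<dots> = (\<Sum>k\<le>L. coeff p k * (A ^\<^sub>m k) $$ (i, j))"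
    using assms by (intro sum.mono_neutral_left) (auto simp: coeff_eq_0)
  finally show ?thesis .
qed

lemma poly_at_mat_dims [simp]:
  "dim_row (poly_at_mat p A) = n" "dim_col (poly_at_mat p A) = n"
  by (rule carrier_matD[OF poly_at_mat_carrier])+

lemma poly_at_mat_0 [simp]: "poly_at_mat 0 A = 0\<^sub>m n n"
  by (rule eq_matI) (auto simp: poly_at_mat_index[of _ 0])

lemma poly_at_mat_add: "poly_at_mat (p + q) A = poly_at_mat p A + poly_at_mat q A"
proof (rule eq_matI)
  fix i j assume ij: "i < dim_row (poly_at_mat p A + poly_at_mat q A)" "j < dim_col (poly_at_mat p A + poly_at_mat q A)"
  let ?L = "max (degree p) (degree q)"
  have "degree (p + q) \<le> ?L" by (intro degree_add_le) auto
  with ij show "poly_at_mat (p + q) A $$ (i, j) = (poly_at_mat p A + poly_at_mat q A) $$ (i, j)"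
    by (simp add: poly_at_mat_index[of _ ?L] sum.distrib algebra_simps)
qed auto

lemma poly_at_mat_smult: "poly_at_mat (Polynomial.smult c p) A = c \<cdot>\<^sub>m poly_at_mat p A"
  by (rule eq_matI)
     (auto simp: poly_at_mat_index[of _ "degree p"] sum_distrib_left mult.assoc)

lemma poly_at_mat_monom: "poly_at_mat (monom 1 k) A = A ^\<^sub>m k"
proof (rule eq_matI)
  fix i j assume "i < dim_row (A ^\<^sub>m k)" "j < dim_col (A ^\<^sub>m k)"
  then have "i < n" "j < n" using A by (auto split: if_splits)
  then show "poly_at_mat (monom 1 k) A $$ (i, j) = (A ^\<^sub>m k) $$ (i, j)"
    by (subst poly_at_mat_index[of _ k]) (auto simp: degree_monom_eq if_distrib[of "\<lambda>x. x * _"] cong: if_cong)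
qed (use A in auto)

lemma poly_at_mat_pCons:
  "poly_at_mat (pCons a p) A = a \<cdot>\<^sub>m 1\<^sub>m n + poly_at_mat p A * A"
proof (rule eq_matI)
  fix i j assume "i < dim_row (a \<cdot>\<^sub>m 1\<^sub>m n + poly_at_mat p A * A)" "j < dim_col (a \<cdot>\<^sub>m 1\<^sub>m n + poly_at_mat p A * A)"
  then have ij: "i < n" "j < n" using A by auto
  let ?L = "degree p"
  have "(poly_at_mat p A * A) $$ (i, j) = (\<Sum>l<n. (\<Sum>k\<le>?L. coeff p k * (A ^\<^sub>m k) $$ (i, l)) * A $$ (l, j))"
    using A ij by (auto simp: scalar_prod_def poly_at_mat_index[of p ?L] atLeast0LessThan intro!: sum.cong)
  also have "\<dots> = (\<Sum>k\<le>?L. coeff p k * (\<Sum>l<n. (A ^\<^sub>m k) $$ (i, l) * A $$ (l, j)))"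
    unfolding sum_distrib_right sum_distrib_left by (subst sum.swap) (simp add: mult.assoc)
  also have "\<dots> = (\<Sum>k\<le>?L. coeff p k * (A ^\<^sub>m Suc k) $$ (i, j))"
    using A ij by (intro sum.cong) (auto simp: scalar_prod_def atLeast0LessThan intro!: sum.cong)
  finally have eq: "(poly_at_mat p A * A) $$ (i, j) = (\<Sum>k\<le>?L. coeff p k * (A ^\<^sub>m Suc k) $$ (i, j))" .
  have "poly_at_mat (pCons a p) A $$ (i, j) = (\<Sum>k\<le>Suc ?L. coeff (pCons a p) k * (A ^\<^sub>m k) $$ (i, j))"
    using ij by (intro poly_at_mat_index degree_pCons_le)
  also have "\<dots> = a * 1\<^sub>m n $$ (i, j) + (poly_at_mat p A * A) $$ (i, j)"
    unfolding sum.atMost_Suc_shift eq using A by (simp del: pow_mat.simps(2))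
  finally show "poly_at_mat (pCons a p) A $$ (i, j) = (a \<cdot>\<^sub>m 1\<^sub>m n + poly_at_mat p A * A) $$ (i, j)"
    using A ij by simp
qed (use A in auto)

lemma poly_at_mat_commute: "poly_at_mat p A * A = A * poly_at_mat p A"
proof (induction p)
  case 0
  show ?case using A by simp
next
  case (pCons a p)
  note c = A poly_at_mat_carrier[of p]
  have "(a \<cdot>\<^sub>m 1\<^sub>m n + poly_at_mat p A * A) * A = a \<cdot>\<^sub>m A + (poly_at_mat p A * A) * A"
    using c by (subst add_mult_distrib_mat[of _ n n]) auto
  also have "\<dots> = a \<cdot>\<^sub>m A + A * (poly_at_mat p A * A)"
    unfolding pCons using c by (simp add: assoc_mult_mat[of _ n n _ n _ n] pCons)
  also have "\<dots> = A * (a \<cdot>\<^sub>m 1\<^sub>m n + poly_at_mat p A * A)"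
    using c by (subst mult_add_distrib_mat[of _ n n]) auto
  finally show ?case unfolding poly_at_mat_pCons .
qed

lemma poly_at_mat_mult: "poly_at_mat (p * q) A = poly_at_mat p A * poly_at_mat q A"
proof (induction p)
  case 0
  show ?case by (simp add: left_mult_zero_mat[of _ n])
next
  case (pCons a p)
  note c = A poly_at_mat_carrier
  have "poly_at_mat (pCons a p * q) A = a \<cdot>\<^sub>m poly_at_mat q A + poly_at_mat p A * poly_at_mat q A * A"
    unfolding mult_pCons_left poly_at_mat_add poly_at_mat_smult poly_at_mat_pCons pCons
    using A by (intro arg_cong2[of _ _ _ _ "(+)"]) auto
  also have "poly_at_mat p A * poly_at_mat q A * A = poly_at_mat p A * A * poly_at_mat q A"
    by (simp only: assoc_mult_mat[OF poly_at_mat_carrier poly_at_mat_carrier A]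
        assoc_mult_mat[OF poly_at_mat_carrier A poly_at_mat_carrier] poly_at_mat_commute[of q])
  also have "a \<cdot>\<^sub>m poly_at_mat q A + \<dots> = (a \<cdot>\<^sub>m 1\<^sub>m n + poly_at_mat p A * A) * poly_at_mat q A"
    using c by (subst add_mult_distrib_mat[of _ n n]) auto
  finally show ?case unfolding poly_at_mat_pCons .
qed

lemma poly_at_mat_eigenvector:
  assumes v: "v \<in> carrier_vec n" "A *\<^sub>v v = l \<cdot>\<^sub>v v"
  shows "poly_at_mat p A *\<^sub>v v = poly p l \<cdot>\<^sub>v v"
proof (induction p)
  case 0
  show ?case using v by (intro eq_vecI) auto
next
  case (pCons a p)
  have smult_vec: "(a \<cdot>\<^sub>m 1\<^sub>m n) *\<^sub>v v = a \<cdot>\<^sub>v v"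
    using v(1) by (intro eq_vecI) auto
  have "poly_at_mat (pCons a p) A *\<^sub>v v = (a \<cdot>\<^sub>m 1\<^sub>m n) *\<^sub>v v + poly_at_mat p A *\<^sub>v (A *\<^sub>v v)"
    unfolding poly_at_mat_pCons using A v
    by (subst add_mult_distrib_mat_vec[of _ n n]) (auto simp: assoc_mult_mat_vec[of _ n n _ n])
  also have "\<dots> = a \<cdot>\<^sub>v v + l \<cdot>\<^sub>v (poly p l \<cdot>\<^sub>v v)"
    unfolding v(2) using v(1) pCons
    by (simp add: mult_mat_vec[of _ n n] smult_vec)
  finally show ?case
    using v(1) by (auto simp: algebra_simps intro!: eq_vecI)
qed

lemma poly_at_mat_eq_0_iff:
  assumes m: "is_minimal_polynomial A m"
  shows "poly_at_mat p A = 0\<^sub>m n n \<longleftrightarrow> m dvd p"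
proof
  have m0: "poly_at_mat m A = 0\<^sub>m n n" and "m \<noteq> 0"
    and min: "\<And>p. p \<noteq> 0 \<Longrightarrow> poly_at_mat p A = 0\<^sub>m n n \<Longrightarrow> degree m \<le> degree p"
    using m A unfolding is_minimal_polynomial_def by auto
  show "poly_at_mat p A = 0\<^sub>m n n" if dvd: "m dvd p"
  proof -
    obtain k where "p = m * k" using dvd by (rule dvdE)
    then show ?thesis by (simp add: poly_at_mat_mult m0 left_mult_zero_mat[of _ n])
  qed
  assume p: "poly_at_mat p A = 0\<^sub>m n n"
  have "poly_at_mat p A = poly_at_mat (m * (p div m)) A + poly_at_mat (p mod m) A"
    unfolding poly_at_mat_add[symmetric] by simp
  then have "poly_at_mat (p mod m) A = 0\<^sub>m n n"
    unfolding p poly_at_mat_mult m0 by (simp add: left_mult_zero_mat[of _ n] left_add_zero_mat[of _ n n])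
  then have "p mod m = 0"
    using min[of "p mod m"] degree_mod_less[OF \<open>m \<noteq> 0\<close>, of p] by fastforce
  then show "m dvd p" by auto
qed

text \<open>If \<open>m = (X - l) p\<close> then \<open>p(A) \<noteq> 0\<close> by minimality, and its nonzero columns are eigenvectors.\<close>
lemma spectrum_eq_roots_minimal_polynomial:
  assumes m: "is_minimal_polynomial A m"
  shows "l \<in> spectrum A \<longleftrightarrow> poly m l = 0"
proof
  have m0: "poly_at_mat m A = 0\<^sub>m n n" and "m \<noteq> 0"
    using m A unfolding is_minimal_polynomial_def by auto
  show "poly m l = 0" if l: "l \<in> spectrum A"
  proof -
    obtain v where v: "v \<in> carrier_vec n" "v \<noteq> 0\<^sub>v n" "A *\<^sub>v v = l \<cdot>\<^sub>v v"
      using l A by (auto simp: spectrum_def eigenvalue_def eigenvector_def)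
    have "poly m l \<cdot>\<^sub>v v = 0\<^sub>m n n *\<^sub>v v"
      using poly_at_mat_eigenvector[OF v(1,3), of m] by (simp add: m0)
    also have "\<dots> = 0\<^sub>v n"
      using v(1) by (intro eq_vecI) auto
    finally have zero: "poly m l \<cdot>\<^sub>v v = 0\<^sub>v n" .
    obtain i where "i < n" "vec_index v i \<noteq> 0"
      using v(1,2) by (metis eq_vecI carrier_vecD index_zero_vec)
    then show ?thesis
      using arg_cong[OF zero, of "\<lambda>w. vec_index w i"] v(1) by simp
  qed
  assume "poly m l = 0"
  then obtain p where p: "m = [:-l, 1:] * p"
    unfolding poly_eq_0_iff_dvd by (rule dvdE)
  with \<open>m \<noteq> 0\<close> have "p \<noteq> 0" by auto
  then have "degree p < degree m"
    unfolding p by (subst degree_mult_eq) auto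
  then have "\<not> m dvd p"
    using \<open>p \<noteq> 0\<close> by (auto dest: dvd_imp_degree_le)
  then have p0: "poly_at_mat p A \<noteq> 0\<^sub>m n n"
    by (simp add: poly_at_mat_eq_0_iff[OF m])
  let ?P = "poly_at_mat p A"
  have "(-l) \<cdot>\<^sub>m ?P + ?P * A = 0\<^sub>m n n"
  proof -
    have "m = Polynomial.smult (-l) p + pCons 0 p" by (simp add: p)
    then have "poly_at_mat m A = (-l) \<cdot>\<^sub>m ?P + (0 \<cdot>\<^sub>m 1\<^sub>m n + ?P * A)"
      by (simp only: poly_at_mat_add poly_at_mat_smult poly_at_mat_pCons)
    also have "0 \<cdot>\<^sub>m 1\<^sub>m n + ?P * A = ?P * A"
      using A by (intro eq_matI) auto
    finally show ?thesis by (simp add: m0)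
  qed
  then have eq: "((-l) \<cdot>\<^sub>m ?P + A * ?P) $$ (i, j) = 0" if "i < n" "j < n" for i j
    using that by (simp add: poly_at_mat_commute)
  have AP: "A * ?P = l \<cdot>\<^sub>m ?P"
  proof (rule eq_matI)
    fix i j assume "i < dim_row (l \<cdot>\<^sub>m ?P)" "j < dim_col (l \<cdot>\<^sub>m ?P)"
    then show "(A * ?P) $$ (i, j) = (l \<cdot>\<^sub>m ?P) $$ (i, j)"
      using eq[of i j] A by (simp del: index_mult_mat(1))
  qed (use A in auto)
  obtain i j where ij: "i < n" "j < n" "?P $$ (i, j) \<noteq> 0"
    using p0 by (metis eq_matI index_zero_mat poly_at_mat_dims)
  have "A *\<^sub>v col ?P j = l \<cdot>\<^sub>v col ?P j"
    using arg_cong[OF AP, of "\<lambda>B. col B j"] A ij col_mult2[OF A poly_at_mat_carrier ij(2), of p]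
    by (simp add: col_smult)
  moreover have "col ?P j \<noteq> 0\<^sub>v n"
  proof
    assume "col ?P j = 0\<^sub>v n"
    then have "vec_index (col ?P j) i = 0" using ij by simp
    then show False using ij by simp
  qed
  moreover have dim: "dim_row A = n"
    using A by simp
  moreover have "col ?P j \<in> carrier_vec (dim_row A)"
    unfolding dim by (rule carrier_vecI) simp
  ultimately have "eigenvector A (col ?P j) l"
    by (simp add: eigenvector_def)
  then show "l \<in> spectrum A"
    by (auto simp: spectrum_def eigenvalue_def)
qed

lemma resolvent_mat_eq:
  assumes "poly_at_mat ([:\<zeta>, -1:] * u) A = 1\<^sub>m n"
  shows "invertible_mat (\<zeta> \<cdot>\<^sub>m 1\<^sub>m n - A)" "resolvent_mat A \<zeta> = poly_at_mat u A"
proof -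
  define R where "R = \<zeta> \<cdot>\<^sub>m 1\<^sub>m n - A"
  let ?U = "poly_at_mat u A"
  have R: "R \<in> carrier_mat n n" using A unfolding R_def by (rule minus_carrier_mat)
  have "poly_at_mat [:\<zeta>, -1:] A = R"
    unfolding poly_at_mat_pCons R_def using A by (intro eq_matI) auto
  then have RU: "R * ?U = 1\<^sub>m n"
    using assms unfolding poly_at_mat_mult by simp
  then have UR: "?U * R = 1\<^sub>m n"
    by (rule mat_mult_left_right_inverse[OF R poly_at_mat_carrier])
  show "invertible_mat (\<zeta> \<cdot>\<^sub>m 1\<^sub>m n - A)"
    unfolding R_def[symmetric] invertible_mat_def inverts_mat_def using R RU UR by auto
  have "R \<in> Units (ring_mat TYPE(complex) n (0::nat))"
    using R RU UR by (auto simp: Units_def ring_mat_def intro!: bexI[of _ ?U])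
  then obtain B where B: "mat_inverse R = Some B"
    using mat_inverse(1)[OF R, of "0::nat"] by fastforce
  then have BR: "B * R = 1\<^sub>m n" "B \<in> carrier_mat n n"
    using mat_inverse(2)[OF R] by auto
  have "B = B * (R * ?U)"
    using BR by (simp add: RU)
  also have "\<dots> = (B * R) * ?U"
    by (rule assoc_mult_mat[OF BR(2) R poly_at_mat_carrier, symmetric])
  finally have "B = ?U"
    using BR by simp
  moreover have "dim_row A = n" using A by simp
  ultimately show "resolvent_mat A \<zeta> = ?U"
    using B by (simp add: resolvent_mat_def R_def)
qed

end

section \<open>The resolvent estimate\<close>

theorem mainTheorem5:
  fixes n :: nat and A :: "complex mat" and m :: "complex poly"
    and N :: "complex mat \<Rightarrow> real" and C :: real and \<zeta> :: complex
  assumes "n \<ge> 1"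
    and "A \<in> carrier_mat n n"
    and "is_minimal_polynomial A m"
    and "is_matrix_norm n N"
    and "bdd_above (range (\<lambda>k. N (A ^\<^sub>m k)))"
    and "C = (SUP k. N (A ^\<^sub>m k))"
  shows "(\<zeta> \<in> cball 0 1 - spectrum A \<longrightarrow>
            invertible_mat (\<zeta> \<cdot>\<^sub>m 1\<^sub>m n - A) \<and>
            N (resolvent_mat A \<zeta>) \<le>
              2 * real (degree m) * C /
                ((MIN l\<in>spectrum A. sqrt (cmod (1 - cnj \<zeta> * l))) *
                 sqrt (2 * real (degree m) - 2 * real (degree m) * (cmod \<zeta>)\<^sup>2
                       + (cmod \<zeta>)\<^sup>2 * (MIN l\<in>spectrum A. cmod (1 - cnj \<zeta> * l)))) *
              sqrt (4 * exp 1 / (cmod (blaschke_product m \<zeta>))\<^sup>2 - 1)) \<and>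
         (cmod \<zeta> > 1 \<longrightarrow>
            invertible_mat (\<zeta> \<cdot>\<^sub>m 1\<^sub>m n - A) \<and>
            N (resolvent_mat A \<zeta>) \<le> C / (cmod \<zeta> - 1))"
  (is "(_ \<longrightarrow> ?inv \<and> _ \<le> 2 * _ * _ / (?sqrt_min * _) * _) \<and> _")
proof -
  note A = assms(2) and m = assms(3)
  have norm: "\<And>X. X \<in> carrier_mat n n \<Longrightarrow> N X = 0 \<longleftrightarrow> X = 0\<^sub>m n n"
    "\<And>X c. X \<in> carrier_mat n n \<Longrightarrow> N (c \<cdot>\<^sub>m X) = cmod c * N X"
    "\<And>X Y. X \<in> carrier_mat n n \<Longrightarrow> Y \<in> carrier_mat n n \<Longrightarrow> N (X + Y) \<le> N X + N Y"
    using assms(4) unfolding is_matrix_norm_def by blast+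
  have monic: "lead_coeff m = 1" and "m \<noteq> 0"
    using m by (auto simp: is_minimal_polynomial_def)
  interpret quotient_norm m "\<lambda>p. N (poly_at_mat p A)" C
  proof
    show "m \<noteq> 0" by fact
    show "N (poly_at_mat p A) = 0 \<longleftrightarrow> m dvd p" for p
      using norm(1)[OF poly_at_mat_carrier[OF A]] poly_at_mat_eq_0_iff[OF A m] by simp
    show "N (poly_at_mat (Polynomial.smult c p) A) = cmod c * N (poly_at_mat p A)" for c p
      unfolding poly_at_mat_smult[OF A] by (rule norm(2)[OF poly_at_mat_carrier[OF A]])
    show "N (poly_at_mat (p + q) A) \<le> N (poly_at_mat p A) + N (poly_at_mat q A)" for p q
      unfolding poly_at_mat_add[OF A] by (intro norm(3) poly_at_mat_carrier[OF A])
    show "N (poly_at_mat (monom 1 k) A) \<le> C" for k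
      unfolding poly_at_mat_monom[OF A] assms(6) by (intro cSUP_upper assms(5)) simp
  qed
  note spectrum = spectrum_eq_roots_minimal_polynomial[OF A m]
  have resolvent: "\<exists>u. m dvd [:\<zeta>, -1:] * u - 1 \<and> ?inv \<and> resolvent_mat A \<zeta> = poly_at_mat u A"
    if notin: "\<zeta> \<notin> spectrum A"
  proof -
    obtain u where u: "m dvd [:\<zeta>, -1:] * u - 1"
      by (rule inverse_modulo_poly[OF \<open>m \<noteq> 0\<close>, of "[:\<zeta>, -1:]"]) (use notin spectrum in \<open>auto simp: algebra_simps\<close>)
    have "[:\<zeta>, -1:] * u = ([:\<zeta>, -1:] * u - 1) + monom 1 0"
      by (simp add: monom_0)
    then have "poly_at_mat ([:\<zeta>, -1:] * u) A = poly_at_mat ([:\<zeta>, -1:] * u - 1) A + 1\<^sub>m n"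
      using poly_at_mat_add[OF A] poly_at_mat_monom[OF A, of 0] A by (metis carrier_matD(1) pow_mat.simps(1))
    also have "\<dots> = 1\<^sub>m n"
      unfolding poly_at_mat_eq_0_iff[OF A m, THEN iffD2, OF u] by simp
    finally show ?thesis
      using resolvent_mat_eq[OF A] u by blast
  qed
  show ?thesis
  proof (intro conjI impI)
    assume z: "\<zeta> \<in> cball 0 1 - spectrum A"
    then have z1: "cmod \<zeta> \<le> 1" and root: "poly m \<zeta> \<noteq> 0"
      using spectrum by auto
    obtain u where u: "m dvd [:\<zeta>, -1:] * u - 1" and inv: "?inv"
      and R: "resolvent_mat A \<zeta> = poly_at_mat u A"
      using resolvent z by blast
    show ?inv by fact
    define \<mu> where "\<mu> = (MIN l\<in>spectrum A. cmod (1 - cnj \<zeta> * l))"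
    have fin: "finite (spectrum A)" "spectrum A \<noteq> {}"
      using card_finite_spectrum(1)[OF A] spectrum_non_empty[OF A] assms(1) by auto
    have "mono sqrt" by (simp add: mono_def)
    from mono_Min_commute[OF this, of "(\<lambda>l. cmod (1 - cnj \<zeta> * l)) ` spectrum A"]
    have sqrt_\<mu>: "?sqrt_min = sqrt \<mu>"
      using fin by (simp add: \<mu>_def image_image)
    have "\<mu> \<in> (\<lambda>l. cmod (1 - cnj \<zeta> * l)) ` spectrum A"
      unfolding \<mu>_def using fin by (intro Min_in) auto
    then obtain l where l: "l \<in> spectrum A" and \<mu>: "\<mu> = cmod (1 - cnj \<zeta> * l)"
      by blast
    have l1: "cmod l \<le> 1"
      using l spectrum root_norm_le_1 by blast
    have zl: "cmod (cnj \<zeta> * l) \<le> cmod \<zeta>"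
      using mult_left_mono[OF l1, of "cmod \<zeta>"] by (simp add: norm_mult)
    have "0 < \<mu>"
    proof (rule ccontr)
      assume "\<not> 0 < \<mu>"
      then have eq: "cnj \<zeta> * l = 1" using \<mu> by simp
      then have "1 \<le> cmod \<zeta>" using zl by simp
      then have "cmod \<zeta> = 1" using z1 by simp
      then have "\<zeta> * cnj \<zeta> = 1"
        by (simp add: complex_norm_square[symmetric])
      then have "l = \<zeta>"
        using arg_cong[OF eq, of "\<lambda>w. \<zeta> * w"] by (simp add: mult.assoc[symmetric])
      then show False using l z by simp
    qed
    moreover have "\<mu> \<le> 2"
      using norm_triangle_ineq4[of 1 "cnj \<zeta> * l"] zl z1 \<mu> by simp
    moreover have "1 - cmod \<zeta> \<le> \<mu>"
      using norm_triangle_ineq2[of 1 "cnj \<zeta> * l"] zl \<mu> by simp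
    moreover have "m = (\<Prod>l\<in>#proots m. [:-l, 1:])"
      using complex_poly_decompose_multiset[of m] monic by simp
    moreover have roots: "l \<in># proots m \<longleftrightarrow> l \<in> spectrum A" for l
      using set_count_proots[OF \<open>m \<noteq> 0\<close>] spectrum by simp
    moreover have "proots m \<noteq> {#}"
      using roots l by fastforce
    moreover have "\<mu> \<le> cmod (1 - cnj \<zeta> * l)" if "l \<in># proots m" for l
      unfolding \<mu>_def using fin that roots by (intro Min_le) auto
    ultimately show "N (resolvent_mat A \<zeta>) \<le>
              2 * real (degree m) * C /
                ((MIN l\<in>spectrum A. sqrt (cmod (1 - cnj \<zeta> * l))) *
                 sqrt (2 * real (degree m) - 2 * real (degree m) * (cmod \<zeta>)\<^sup>2
                       + (cmod \<zeta>)\<^sup>2 * (MIN l\<in>spectrum A. cmod (1 - cnj \<zeta> * l)))) *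
              sqrt (4 * exp 1 / (cmod (blaschke_product m \<zeta>))\<^sup>2 - 1)"
      unfolding R sqrt_\<mu> \<mu>_def[symmetric] blaschke_product_def size_proots_complex[symmetric]
      by (intro resolvent_le_inside[OF _ _ z1 root u])
  next
    assume z: "cmod \<zeta> > 1"
    then have "\<zeta> \<notin> spectrum A"
      using spectrum root_norm_le_1 by fastforce
    then obtain u where "m dvd [:\<zeta>, -1:] * u - 1" "?inv" "resolvent_mat A \<zeta> = poly_at_mat u A"
      using resolvent by blast
    then show ?inv "N (resolvent_mat A \<zeta>) \<le> C / (cmod \<zeta> - 1)"
      using resolvent_le_outside[OF z] by simp_all
  qed
qed

end
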